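(* For any realization $(x_1,\dots,x_n)$ of $(X_1,\dots,X_n)$ and any integer $m\ge1$, $$\mathbb E\Big(\mathbb L\big((\hat g_1^n)_{\hat k}\big)-\mathbb L\big((\hat g_1^n)_{\tilde k}\big)\Big)\le2\sqrt{\frac{\ln\big(eN\big(2\exp(\frac{\ln 2}{t_{mix}})+1\big)\big)(1+9\ln 2)\,t_{mix}}{m\ln 2}}.$$ Equivalently, if $g^*$ denotes the best prediction function, $$\mathbb E\Big(\mathbb L\big((\hat g_1^n)_{\hat k}\big)-\mathbb L(g^* )\Big)\le\mathbb L\big((\hat g_1^n)_{\tilde k}\big)-\mathbb L(g^* )+2\sqrt{\frac{\ln\big(eN\big(2\exp(\frac{\ln 2}{t_{mix}})+1\big)\big)(1+9\ln 2)\,t_{mix}}{m\ln 2}}.$$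
   Context: Process. Let $\mathcal Y$ be a Polish space and $(Y_t)_{t\in\mathbb Z}$ a $\mathcal Y$-valued Markov chain of order $k_0$ that is time homogeneous, stationary and uniformly ergodic. Fix an integer $p\ge k_0$ and put $X_t=(Y_t,Y_{t-1},\dots,Y_{t-p})^T$, with values in $\mathcal X=\mathcal Y^{p+1}$. Then $(X_t)_{t\in\mathbb Z}$ is a time homogeneous, stationary, uniformly ergodic Markov chain of order $1$; $K$ denotes its transition kernel and $Q$ its stationary law. With $d_{TV}(P,P')=\sup_A|P(A)-P'(A)|$, uniform ergodicity means that there are $C>0$ and $0<\rho<1$ with $\sup_{x\in\mathcal X}d_{TV}(K^n(x,\cdot),Q)\le C\rho^n$ for all $n$. The mixing time is $t_{mix}=\min\{t\ge 1:\ \sup_{x\in\mathcal X}d_{TV}(K^t(x,\cdot),Q)\le 1/4\}$. Losses. A prediction function is a measurable $g:\mathcal Y^p\to\mathcal Y$; $\mathcal F$ is the set of all of them. A loss function is a measurable $L:\mathcal Y^2\to[0,1]$; write $L(g(X_t)):=L(g(Y_{t-1},\dots,Y_{t-p}),Y_t)$. The expected loss is $\mathbb L(g)=\mathbb E_Q(L(g(X)))$ with $X\sim Q$, and the best prediction function is $g^*\in\arg\min_{g\in\mathcal F}\mathbb L(g)$. The out-of-sample empirical loss on the validation set $(X_{n+1},\dots,X_{n+m})$ is $\hat L_m(g)=\frac1m\sum_{j=n+1}^{n+m}L(g(X_j))$. Estimators and selection. Let $\tilde L$ be a loss function (possibly different from $L$), $N$ a positive integer and $\mathcal G_1,\dots,\mathcal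 G_N\subset\mathcal F$. For a realization $x_1,\dots,x_n$ of the learning set $X_1,\dots,X_n$, $(\hat g_1^n)_k\in\arg\min_{g\in\mathcal G_k}\sum_{t=1}^n\tilde L(g(x_t))$, $k=1,\dots,N$. Put $\tilde k\in\arg\min_{1\le k\le N}\mathbb L((\hat g_1^n)_k)$ and $\hat k\in\arg\min_{1\le k\le N}\hat L_m((\hat g_1^n)_k)$ ($\hat k$ depends on the validation set and is random). $\mathbb E$ is taken conditionally on $X_1=x_1,\dots,X_n=x_n$; thus the functions $(\hat g_1^n)_k$ are fixed, and $(X_{n+j})_{j\ge1}$ is the chain with kernel $K$ started from $X_n=x_n$. *)

theory Defs
  imports "HOL-Probability.Probability"
begin

text \<open>
  A point of the \<open>r\<close>-fold power of the state space is an extensional function on \<open>{..<r}\<close>.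
  Blocks run backwards in time: coordinate \<open>i\<close> of the block at time \<open>t\<close> is the value of the
  process at time \<open>t - i\<close>.
\<close>

abbreviation blocks :: "nat \<Rightarrow> (nat \<Rightarrow> 'y::topological_space) measure" where
  "blocks r \<equiv> PiM {..<r} (\<lambda>_. borel)"

definition block :: "(int \<Rightarrow> 'w \<Rightarrow> 'y) \<Rightarrow> nat \<Rightarrow> int \<Rightarrow> 'w \<Rightarrow> nat \<Rightarrow> 'y" where
  "block Y r t \<omega> = (\<lambda>i\<in>{..<r}. Y (t - int i) \<omega>)"


subsection \<open>Markov chains of order \<open>k\<close>\<close>

definition past :: "'w measure \<Rightarrow> (int \<Rightarrow> 'w \<Rightarrow> 'y::topological_space) \<Rightarrow> int \<Rightarrow> 'w measure" where
  "past M Y t = vimage_algebra (space M) (\<lambda>\<omega>. \<lambda>s\<in>{..<t}. Y s \<omega>) (PiM {..<t} (\<lambda>_. borel))"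

text \<open>Time homogeneity is expressed by the transition kernel \<open>\<kappa>\<close> not depending on the time \<open>t\<close>.\<close>

definition homogeneous_markov_chain ::
  "'w measure \<Rightarrow> nat \<Rightarrow> ((nat \<Rightarrow> 'y) \<Rightarrow> 'y measure) \<Rightarrow> (int \<Rightarrow> 'w \<Rightarrow> 'y::topological_space) \<Rightarrow> bool"
where
  "homogeneous_markov_chain M k \<kappa> Y \<longleftrightarrow>
     prob_space M \<and> (\<forall>t. Y t \<in> M \<rightarrow>\<^sub>M borel) \<and> \<kappa> \<in> blocks k \<rightarrow>\<^sub>M prob_algebra borel \<and>
     (\<forall>t. \<forall>A\<in>sets borel. AE \<omega> in M.
        real_cond_exp M (past M Y t) (indicator (Y t -` A \<inter> space M)) \<omega>
          = measure (\<kappa> (block Y k (t - 1) \<omega>)) A)"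

definition stationary :: "'w measure \<Rightarrow> (int \<Rightarrow> 'w \<Rightarrow> 'y::topological_space) \<Rightarrow> bool" where
  "stationary M Y \<longleftrightarrow>
     (\<forall>h. distr M (PiM UNIV (\<lambda>_. borel)) (\<lambda>\<omega> t. Y (t + h) \<omega>)
        = distr M (PiM UNIV (\<lambda>_. borel)) (\<lambda>\<omega> t. Y t \<omega>))"

text \<open>
  For \<open>r \<ge> k\<close> the blocks of length \<open>r\<close> of a chain of order \<open>k\<close> form a chain of order \<open>1\<close>: a new
  value is drawn from \<open>\<kappa>\<close> given the \<open>k\<close> most recent values, put in front, and the oldest
  coordinate is dropped.
\<close>

definition block_kernel ::
  "nat \<Rightarrow> ((nat \<Rightarrow> 'y) \<Rightarrow> 'y measure) \<Rightarrow> nat \<Rightarrow> (nat \<Rightarrow> 'y) \<Rightarrow> (nat \<Rightarrow> 'y::topological_space) measure"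
where
  "block_kernel k \<kappa> r x =
     distr (\<kappa> (restrict x {..<k})) (blocks r)
       (\<lambda>y. \<lambda>i\<in>{..<r}. case i of 0 \<Rightarrow> y | Suc j \<Rightarrow> x j)"

definition block_law :: "'w measure \<Rightarrow> (int \<Rightarrow> 'w \<Rightarrow> 'y) \<Rightarrow> nat \<Rightarrow> (nat \<Rightarrow> 'y::topological_space) measure"
where
  "block_law M Y r = distr M (blocks r) (block Y r 0)"


subsection \<open>Uniform ergodicity and mixing time of a chain of order 1\<close>

definition d_TV :: "'a measure \<Rightarrow> 'a measure \<Rightarrow> real" where
  "d_TV P P' = (SUP A\<in>sets P. \<bar>measure P A - measure P' A\<bar>)"

primrec kernel_power :: "'a measure \<Rightarrow> ('a \<Rightarrow> 'a measure) \<Rightarrow> nat \<Rightarrow> 'a \<Rightarrow> 'a measure" where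
  "kernel_power S K 0 x = return S x"
| "kernel_power S K (Suc n) x = kernel_power S K n x \<bind> K"

definition uniformly_ergodic :: "'a measure \<Rightarrow> ('a \<Rightarrow> 'a measure) \<Rightarrow> 'a measure \<Rightarrow> bool" where
  "uniformly_ergodic S K Q \<longleftrightarrow>
     (\<exists>C>0. \<exists>\<rho>. 0 < \<rho> \<and> \<rho> < 1 \<and>
        (\<forall>n. (SUP x\<in>space S. d_TV (kernel_power S K n x) Q) \<le> C * \<rho> ^ n))"

definition mixing_time :: "'a measure \<Rightarrow> ('a \<Rightarrow> 'a measure) \<Rightarrow> 'a measure \<Rightarrow> nat" where
  "mixing_time S K Q =
     (LEAST t. 1 \<le> t \<and> (SUP x\<in>space S. d_TV (kernel_power S K t x) Q) \<le> 1 / 4)"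

text \<open>
  A chain of order \<open>k \<ge> 1\<close> is uniformly ergodic if the order \<open>1\<close> chain formed by its last \<open>k\<close>
  values is.
\<close>

definition uniformly_ergodic_chain ::
  "'w measure \<Rightarrow> nat \<Rightarrow> ((nat \<Rightarrow> 'y) \<Rightarrow> 'y measure) \<Rightarrow> (int \<Rightarrow> 'w \<Rightarrow> 'y::topological_space) \<Rightarrow> bool"
where
  "uniformly_ergodic_chain M k \<kappa> Y \<longleftrightarrow>
     uniformly_ergodic (blocks k) (block_kernel k \<kappa> k) (block_law M Y k)"

text \<open>
  Law of \<open>(X\<^sub>n\<^sub>+\<^sub>1, \<dots>, X\<^sub>n\<^sub>+\<^sub>m)\<close> for the chain with kernel \<open>K\<close> started from \<open>X\<^sub>n = x\<close>.
  \<open>Ionescu_Tulcea.C \<dots> 0 (Suc m)\<close> is the joint law of the \<open>m + 1\<close> coordinates \<open>X\<^sub>n, \<dots>, X\<^sub>n\<^sub>+\<^sub>m\<close>, indexed by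
  \<open>{0..<m + 1}\<close>; the initial coordinate is then dropped and the others are re-indexed by
  \<open>{n + 1..n + m}\<close>.
\<close>

definition validation_law ::
  "'a measure \<Rightarrow> ('a \<Rightarrow> 'a measure) \<Rightarrow> 'a \<Rightarrow> nat \<Rightarrow> nat \<Rightarrow> (nat \<Rightarrow> 'a) measure"
where
  "validation_law S K x n m =
     distr
       (Ionescu_Tulcea.C (\<lambda>i \<omega>. if i = 0 then return S x else K (\<omega> (i - 1))) (\<lambda>_. S)
          0 (Suc m) (\<lambda>_. undefined))
       (PiM {n + 1..n + m} (\<lambda>_. S))
       (\<lambda>\<omega>. \<lambda>j\<in>{n + 1..n + m}. \<omega> (j - n))"


subsection \<open>Prediction functions and losses\<close>

definition predictors :: "nat \<Rightarrow> ((nat \<Rightarrow> 'y) \<Rightarrow> 'y::topological_space) set" where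
  "predictors p = blocks p \<rightarrow>\<^sub>M borel"

definition loss_function :: "('y::topological_space \<times> 'y \<Rightarrow> real) \<Rightarrow> bool" where
  "loss_function L \<longleftrightarrow>
     L \<in> borel \<Otimes>\<^sub>M borel \<rightarrow>\<^sub>M borel \<and> (\<forall>z. 0 \<le> L z \<and> L z \<le> 1)"

definition loss_at ::
  "('y \<times> 'y \<Rightarrow> real) \<Rightarrow> nat \<Rightarrow> ((nat \<Rightarrow> 'y) \<Rightarrow> 'y) \<Rightarrow> (nat \<Rightarrow> 'y) \<Rightarrow> real"
where
  "loss_at L p g x = L (g (\<lambda>i\<in>{..<p}. x (Suc i)), x 0)"

definition expected_loss ::
  "(nat \<Rightarrow> 'y) measure \<Rightarrow> ('y \<times> 'y \<Rightarrow> real) \<Rightarrow> nat \<Rightarrow> ((nat \<Rightarrow> 'y) \<Rightarrow> 'y) \<Rightarrow> real"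
where
  "expected_loss Q L p g = (\<integral>x. loss_at L p g x \<partial>Q)"

definition empirical_loss ::
  "('y \<times> 'y \<Rightarrow> real) \<Rightarrow> nat \<Rightarrow> nat \<Rightarrow> nat \<Rightarrow> (nat \<Rightarrow> nat \<Rightarrow> 'y) \<Rightarrow> ((nat \<Rightarrow> 'y) \<Rightarrow> 'y) \<Rightarrow> real"
where
  "empirical_loss L p n m v g = (1 / real m) * (\<Sum>j = n + 1..n + m. loss_at L p g (v j))"

end

theory Submission
  imports Defs
begin

text \<open>
  Let \<open>t\<close> be the mixing time. The validation sum \<open>f X\<^sub>1 + \<dots> + f X\<^sub>m\<close> splits into the \<open>t\<close> sums along
  the residue classes modulo \<open>t\<close>; by convexity of the exponential, its moment generating function
  at \<open>\<lambda>\<close> is at most the mean of theirs at \<open>\<lambda> t\<close>. Each such sum runs along a chain with kernel \<open>K\<^sup>t\<close>,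
  which maps a \<open>Q\<close>-centred function with range in an interval of length \<open>2\<close> to one bounded by \<open>1/2\<close>;
  peeling off the last summand and applying Hoeffding's lemma to \<open>K\<^sup>t\<close> costs a factor
  \<open>exp (\<lambda>\<^sup>2 t\<^sup>2 / 2)\<close> per summand. A union bound over the \<open>N\<close> candidates and optimization of \<open>\<lambda>\<close> give
  \<open>6 sqrt (B t / m)\<close> with \<open>B \<ge> 1 + ln N\<close>, which is smaller than the stated bound.

  The mixing time is meaningful because, for \<open>k\<^sub>0 \<le> r\<close>, the law of a long block of length \<open>r\<close> after
  \<open>s + (r - k\<^sub>0)\<close> steps is the image of the law of the short block of length \<open>k\<^sub>0\<close> after \<open>s\<close> steps under
  one fixed kernel, and kernels do not increase the total variation distance.
\<close>

subsection \<open>Total variation distance\<close>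

lemma abs_measure_diff_le_1:
  assumes "prob_space P" "prob_space P'"
  shows "\<bar>measure P A - measure P' A\<bar> \<le> 1"
proof -
  have "measure P A \<le> 1" "measure P' A \<le> 1"
    using assms by (auto intro: prob_space.prob_le_1)
  then show ?thesis
    using measure_nonneg[of P A] measure_nonneg[of P' A] by linarith
qed

text \<open>Suprema of reals are usable as upper bounds only for bounded families; for probability
  measures the constant 1 bounds the family of differences.\<close>

lemma abs_measure_diff_le_d_TV:
  assumes "prob_space P" "prob_space P'" "A \<in> sets P"
  shows "\<bar>measure P A - measure P' A\<bar> \<le> d_TV P P'"
  unfolding d_TV_def using assms
  by (intro cSUP_upper bdd_aboveI2[where M = 1] abs_measure_diff_le_1)

lemma d_TV_le:
  assumes "\<And>A. A \<in> sets P \<Longrightarrow> \<bar>measure P A - measure P' A\<bar> \<le> c"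
  shows "d_TV P P' \<le> c"
  unfolding d_TV_def using assms by (intro cSUP_least) auto

lemma d_TV_le_1:
  assumes "prob_space P" "prob_space P'"
  shows "d_TV P P' \<le> 1"
  using assms by (intro d_TV_le abs_measure_diff_le_1)

text \<open>Discrete layer-cake formula: the number of thresholds \<open>i / n\<close> not exceeding
  \<open>y\<close> is the integer part of \<open>n * y\<close>. It serves to pass from events to
  functions with values in the unit interval.\<close>

lemma sum_threshold_indicator:
  fixes y :: real
  assumes y: "0 \<le> y" "y \<le> 1" and n: "0 < n"
  shows "\<bar>y - (\<Sum>i = 1..n. of_bool (real i \<le> real n * y)) / real n\<bar> \<le> 1 / real n"
proof -
  define k where "k = nat \<lfloor>real n * y\<rfloor>"
  have k: "real k \<le> real n * y" "real n * y < real k + 1"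
    using y n by (auto simp: k_def of_nat_nat)
  have kn: "k \<le> n"
  proof -
    have "real n * y \<le> real n"
      using y by (simp add: mult_left_le)
    then show ?thesis using k by linarith
  qed
  have "{i \<in> {1..n}. real i \<le> real n * y} = {1..k}"
  proof (intro set_eqI iffI)
    fix i assume "i \<in> {i \<in> {1..n}. real i \<le> real n * y}"
    then have "1 \<le> i" "real i < real k + 1" using k by auto
    then show "i \<in> {1..k}" by auto
  next
    fix i assume "i \<in> {1..k}"
    then have "1 \<le> i" "i \<le> k" by auto
    then show "i \<in> {i \<in> {1..n}. real i \<le> real n * y}"
      using k kn by (auto intro: order.trans[of _ "real k"])
  qed
  then have "(\<Sum>i = 1..n. of_bool (real i \<le> real n * y)) = real k"
    by (simp add: sum_of_bool_eq Int_def)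
  moreover have "y - real k / real n = (real n * y - real k) / real n"
    using n by (simp add: field_simps)
  ultimately show ?thesis
    using k n by (simp add: divide_right_mono)
qed

text \<open>Up to an error \<open>1 / n\<close>, \<open>F\<close> is the average of the indicators
  of \<open>n\<close> superlevel sets, and the mean of each indicator changes by at most
  \<open>d_TV P P'\<close>. Hence the factor is 1, with no loss of a factor 2.\<close>

lemma d_TV_integral_unit:
  assumes P: "prob_space P" and P': "prob_space P'" and sets [measurable_cong]: "sets P' = sets P"
    and F [measurable]: "F \<in> borel_measurable P"
    and F01: "\<And>x. x \<in> space P \<Longrightarrow> 0 \<le> F x \<and> F x \<le> (1::real)"
  shows "\<bar>(\<integral>x. F x \<partial>P) - (\<integral>x. F x \<partial>P')\<bar> \<le> d_TV P P'"
proof -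
  interpret P: prob_space P by fact
  interpret P': prob_space P' by fact
  \<comment> \<open>The error \<open>2 / n\<close> is \<open>1 / n\<close> under each of the two
    measures; it vanishes in the limit at the end.\<close>
  have *: "\<bar>(\<integral>x. F x \<partial>P) - (\<integral>x. F x \<partial>P')\<bar> \<le> d_TV P P' + 2 / real n" if n: "0 < n" for n :: nat
  proof -
    define A where "A i = {x \<in> space P. real i \<le> real n * F x}" for i
    have A [measurable]: "A i \<in> sets P" for i
      by (simp add: A_def)
    define Fn where "Fn x = (\<Sum>i = 1..n. indicator (A i) x) / real n" for x
    have Fn_close: "\<bar>F x - Fn x\<bar> \<le> 1 / real n" if "x \<in> space P" for x
    proof -
      have "Fn x = (\<Sum>i = 1..n. of_bool (real i \<le> real n * F x)) / real n"
        unfolding Fn_def using that by (simp add: A_def indicator_def of_bool_def)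
      then show ?thesis
        using sum_threshold_indicator[OF _ _ n, of "F x"] F01[OF that] by simp
    qed
    have near: "\<bar>(\<integral>x. F x \<partial>R) - (\<integral>x. Fn x \<partial>R)\<bar> \<le> 1 / real n \<and>
        (\<integral>x. Fn x \<partial>R) = (\<Sum>i = 1..n. measure R (A i)) / real n"
      if R: "prob_space R" and sR [measurable_cong]: "sets R = sets P" for R
    proof
      interpret R: prob_space R by fact
      have spR: "space R = space P" using sR by (rule sets_eq_imp_space_eq)
      have iA: "integrable R (indicator (A i) :: _ \<Rightarrow> real)" for i
        using A sR by (simp add: R.emeasure_eq_measure)
      have iF: "integrable R F"
        by (rule R.integrable_const_bound[where B = 1]) (use F01 spR in auto)
      have iFn: "integrable R Fn"
        unfolding Fn_def using iA by auto
      have "\<bar>(\<integral>x. F x \<partial>R) - (\<integral>x. Fn x \<partial>R)\<bar> = \<bar>\<integral>x. F x - Fn x \<partial>R\<bar>"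
        using iF iFn by simp
      also have "\<dots> \<le> (\<integral>x. \<bar>F x - Fn x\<bar> \<partial>R)"
        by (rule integral_abs_bound)
      also have "\<dots> \<le> (\<integral>x. 1 / real n \<partial>R)"
        using iF iFn Fn_close spR by (intro integral_mono) auto
      finally show "\<bar>(\<integral>x. F x \<partial>R) - (\<integral>x. Fn x \<partial>R)\<bar> \<le> 1 / real n"
        by (simp add: R.prob_space)
      show "(\<integral>x. Fn x \<partial>R) = (\<Sum>i = 1..n. measure R (A i)) / real n"
        unfolding Fn_def using iA A sR spR sets.sets_into_space[OF A]
        by (simp add: Int_absorb2 Int_absorb1)
    qed
    have "\<bar>(\<integral>x. Fn x \<partial>P) - (\<integral>x. Fn x \<partial>P')\<bar>
        = \<bar>\<Sum>i = 1..n. measure P (A i) - measure P' (A i)\<bar> / real n"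
      using near[OF P] near[OF P' sets] n
      by (simp add: sum_subtractf diff_divide_distrib[symmetric])
    also have "\<dots> \<le> (\<Sum>i = 1..n. \<bar>measure P (A i) - measure P' (A i)\<bar>) / real n"
      by (intro divide_right_mono sum_abs) auto
    also have "\<dots> \<le> (\<Sum>i = 1..n. d_TV P P') / real n"
      by (intro divide_right_mono sum_mono abs_measure_diff_le_d_TV P P' A) auto
    also have "\<dots> = d_TV P P'" using n by simp
    finally show ?thesis
      using near[OF P refl] near[OF P' sets] by linarith
  qed
  show ?thesis
  proof (rule LIMSEQ_le_const)
    show "(\<lambda>n. d_TV P P' + 2 / real n) \<longlonglongrightarrow> d_TV P P'"
      using tendsto_add[OF tendsto_const lim_const_over_n[of "2::real"]] by simp
    show "\<exists>N. \<forall>n\<ge>N. \<bar>(\<integral>x. F x \<partial>P) - (\<integral>x. F x \<partial>P')\<bar> \<le> d_TV P P' + 2 / real n"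
      using * by (intro exI[of _ 1]) auto
  qed
qed

text \<open>Rescale \<open>F\<close> affinely to the unit interval: the additive constant cancels
  between two probability measures, so only the width \<open>c\<close> of the range counts.\<close>

lemma d_TV_integral:
  assumes P: "prob_space P" and P': "prob_space P'" and sets [measurable_cong]: "sets P' = sets P"
    and F [measurable]: "F \<in> borel_measurable P"
    and Fab: "\<And>x. x \<in> space P \<Longrightarrow> a \<le> F x \<and> F x \<le> (a + c::real)" and c: "0 < c"
  shows "\<bar>(\<integral>x. F x \<partial>P) - (\<integral>x. F x \<partial>P')\<bar> \<le> c * d_TV P P'"
proof -
  interpret P: prob_space P by fact
  interpret P': prob_space P' by fact
  have sp: "space P' = space P"
    using sets by (rule sets_eq_imp_space_eq)
  define H where "H x = (F x - a) / c" for x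
  have [measurable]: "H \<in> borel_measurable P" by (simp add: H_def[abs_def])
  have H01: "0 \<le> H x \<and> H x \<le> 1" if "x \<in> space P" for x
    using Fab[OF that] c by (simp add: H_def field_simps)
  have F_eq: "F = (\<lambda>x. a + c * H x)"
    using c by (auto simp: H_def)
  have i: "integrable P H" "integrable P' H"
    using H01 sp by (auto intro!: P.integrable_const_bound[where B = 1] P'.integrable_const_bound[where B = 1])
  have "(\<integral>x. F x \<partial>P) - (\<integral>x. F x \<partial>P') = c * ((\<integral>x. H x \<partial>P) - (\<integral>x. H x \<partial>P'))"
    unfolding F_eq using i by (simp add: P.prob_space P'.prob_space algebra_simps)
  then show ?thesis
    using d_TV_integral_unit[OF P P' sets \<open>H \<in> borel_measurable P\<close> H01] c by (simp add: abs_mult)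
qed

subsection \<open>Paths of a Markov kernel\<close>

text \<open>Fubini for a mixture of kernels with the Bochner integral: the bind is the join of the
  image of \<open>P\<close> under \<open>R\<close>, and boundedness of \<open>f\<close> supplies the
  integrability.\<close>

lemma integral_bind_bounded:
  fixes f :: "'b \<Rightarrow> real"
  assumes P: "P \<in> space (prob_algebra M)" and R: "R \<in> M \<rightarrow>\<^sub>M prob_algebra N"
    and f: "f \<in> borel_measurable N" "\<And>x. x \<in> space N \<Longrightarrow> \<bar>f x\<bar> \<le> B"
  shows "(\<integral>x. f x \<partial>(P \<bind> R)) = (\<integral>x. (\<integral>y. f y \<partial>R x) \<partial>P)"
proof -
  have sP: "sets P = sets M" and pP: "prob_space P"
    using P by (auto simp: space_prob_algebra)
  interpret P: prob_space P by fact
  have R': "R \<in> P \<rightarrow>\<^sub>M subprob_algebra N"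
    using measurable_prob_algebraD[OF R] sP by (simp cong: measurable_cong_sets)
  have "P \<bind> R = join (distr P (subprob_algebra N) R)"
    by (rule bind_nonempty''[OF R' P.not_empty])
  then have "(\<integral>x. f x \<partial>(P \<bind> R)) = (\<integral>R'. (\<integral>y. f y \<partial>R') \<partial>distr P (subprob_algebra N) R)"
    using f R'
    by (auto intro!: integral_join[where B = B and B' = 1 and N = N] P.finite_measure_distr
        simp: AE_distr_iff subprob_space.subprob_emeasure_le_1 subprob_space_kernel)
  also have "\<dots> = (\<integral>x. (\<integral>y. f y \<partial>R x) \<partial>P)"
    using f R' by (intro integral_distr) auto
  finally show ?thesis .
qed

section \<open>Powers of a Markov kernel\<close>

locale markov_kernel =
  fixes S :: "'a measure" and K :: "'a \<Rightarrow> 'a measure"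
  assumes kernel: "K \<in> S \<rightarrow>\<^sub>M prob_algebra S"
begin

lemma kernel_subprob [measurable]: "K \<in> S \<rightarrow>\<^sub>M subprob_algebra S"
  by (rule measurable_prob_algebraD[OF kernel])

lemma kernel_power_measurable: "kernel_power S K n \<in> S \<rightarrow>\<^sub>M prob_algebra S"
proof (induction n)
  case 0
  have "kernel_power S K 0 = return S" by (rule ext) simp
  then show ?case by simp
next
  case (Suc n)
  have "kernel_power S K (Suc n) = (\<lambda>x. kernel_power S K n x \<bind> K)" by (rule ext) simp
  then show ?case by (simp add: measurable_bind_prob_space[OF Suc kernel])
qed

lemma kernel_power_subprob [measurable]: "kernel_power S K n \<in> S \<rightarrow>\<^sub>M subprob_algebra S"
  by (rule measurable_prob_algebraD[OF kernel_power_measurable])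

lemma kernel_power_space:
  assumes "x \<in> space S"
  shows "kernel_power S K n x \<in> space (prob_algebra S)"
  using measurable_space[OF kernel_power_measurable assms] .

lemma sets_kernel_power: "x \<in> space S \<Longrightarrow> sets (kernel_power S K n x) = sets S"
  and space_kernel_power: "x \<in> space S \<Longrightarrow> space (kernel_power S K n x) = space S"
  and prob_space_kernel_power: "x \<in> space S \<Longrightarrow> prob_space (kernel_power S K n x)"
  using kernel_power_space[of x n] by (auto simp: space_prob_algebra dest: sets_eq_imp_space_eq)

lemma nn_integral_kernel_power_Suc:
  assumes x: "x \<in> space S" and f [measurable]: "f \<in> borel_measurable S"
  shows "(\<integral>\<^sup>+y. f y \<partial>kernel_power S K (Suc n) x) = (\<integral>\<^sup>+y. (\<integral>\<^sup>+z. f z \<partial>K y) \<partial>kernel_power S K n x)"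
  using kernel_subprob sets_kernel_power[OF x, of n]
  by (simp add: nn_integral_bind[where B = S] cong: measurable_cong_sets)

section \<open>Joint law of the path started at a point\<close>

definition P_path :: "'a \<Rightarrow> nat \<Rightarrow> (nat \<Rightarrow> 'a) \<Rightarrow> 'a measure" where
  "P_path x i \<omega> = (if i = 0 then return S x else K (\<omega> (i - 1)))"

lemma Ionescu_Tulcea_path:
  assumes x: "x \<in> space S"
  shows "Ionescu_Tulcea (P_path x) (\<lambda>_. S)"
proof (rule Ionescu_Tulcea.intro)
  fix i :: nat
  show "P_path x i \<in> PiM {0..<i} (\<lambda>_. S) \<rightarrow>\<^sub>M subprob_algebra S"
  proof (cases "i = 0")
    case True
    then have "P_path x i = (\<lambda>_. return S x)" by (auto simp: P_path_def fun_eq_iff)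
    then show ?thesis using x by (simp add: measurable_space[OF return_measurable])
  next
    case False
    then have *: "P_path x i = (\<lambda>\<omega>. K (\<omega> (i - 1)))" by (auto simp: P_path_def fun_eq_iff)
    show ?thesis unfolding * using False
      by (intro measurable_compose[OF _ kernel_subprob] measurable_component_singleton) auto
  qed
next
  fix i :: nat and \<omega> :: "nat \<Rightarrow> 'a"
  assume \<omega>: "\<omega> \<in> space (PiM {0..<i} (\<lambda>_. S))"
  show "prob_space (P_path x i \<omega>)"
  proof (cases "i = 0")
    case False
    then have "\<omega> (i - 1) \<in> space S" using \<omega> by (auto simp: space_PiM)
    from measurable_space[OF kernel this] False show ?thesis
      by (simp add: P_path_def space_prob_algebra)
  qed (simp add: P_path_def prob_space_return x)
qed

text \<open>The time parameter is the last time \<open>m\<close>; the construction takes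
  \<open>Suc m\<close> coordinates because the deterministic starting point occupies coordinate 0.
  The step kernels have the form used in \<open>validation_law\<close>, so both refer to the same
  measure.\<close>

definition path_law :: "'a \<Rightarrow> nat \<Rightarrow> (nat \<Rightarrow> 'a) measure" where
  "path_law x m = Ionescu_Tulcea.C (P_path x) (\<lambda>_. S) 0 (Suc m) (\<lambda>_. undefined)"

lemma undefined_space: "(\<lambda>_. undefined) \<in> space (PiM {0..<0::nat} (\<lambda>_. S))"
  by (simp add: space_PiM)

lemma
  assumes x: "x \<in> space S"
  shows sets_path_law: "sets (path_law x m) = sets (PiM {0..<Suc m} (\<lambda>_. S))"
    and space_path_law: "space (path_law x m) = space (PiM {0..<Suc m} (\<lambda>_. S))"
    and prob_space_path_law: "prob_space (path_law x m)"
proof -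
  interpret Ionescu_Tulcea "P_path x" "\<lambda>_. S" by (rule Ionescu_Tulcea_path[OF x])
  show "sets (path_law x m) = sets (PiM {0..<Suc m} (\<lambda>_. S))"
    unfolding path_law_def using sets_C[OF undefined_space, of "Suc m"] by (simp del: C.simps)
  then show "space (path_law x m) = space (PiM {0..<Suc m} (\<lambda>_. S))"
    by (rule sets_eq_imp_space_eq)
  show "prob_space (path_law x m)"
    unfolding path_law_def by (rule prob_space_C[OF undefined_space])
qed

text \<open>The last coordinate is integrated out first. Nonnegative integrals are used so that no
  integrability has to be checked for the exponentials treated later.\<close>

lemma nn_integral_path_law_Suc:
  assumes x: "x \<in> space S" and f: "f \<in> borel_measurable (PiM {0..<Suc (Suc m)} (\<lambda>_. S))"
  shows "(\<integral>\<^sup>+\<omega>. f \<omega> \<partial>path_law x (Suc m)) = (\<integral>\<^sup>+\<omega>. (\<integral>\<^sup>+y. f (fun_upd \<omega> (Suc m) y) \<partial>K (\<omega> m)) \<partial>path_law x m)"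
proof -
  interpret Ionescu_Tulcea "P_path x" "\<lambda>_. S" by (rule Ionescu_Tulcea_path[OF x])
  have "path_law x (Suc m) = path_law x m \<bind> eP (Suc m)"
    unfolding path_law_def by simp
  then have "(\<integral>\<^sup>+\<omega>. f \<omega> \<partial>path_law x (Suc m)) = (\<integral>\<^sup>+\<omega>. (\<integral>\<^sup>+\<omega>'. f \<omega>' \<partial>eP (Suc m) \<omega>) \<partial>path_law x m)"
    using f measurable_eP[of "Suc m"] sets_path_law[OF x, of m]
    by (simp add: nn_integral_bind[where B = "PiM {0..<Suc (Suc m)} (\<lambda>_. S)"] cong: measurable_cong_sets)
  also have "\<dots> = (\<integral>\<^sup>+\<omega>. (\<integral>\<^sup>+y. f (fun_upd \<omega> (Suc m) y) \<partial>K (\<omega> m)) \<partial>path_law x m)"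
  proof (rule nn_integral_cong)
    fix \<omega> assume "\<omega> \<in> space (path_law x m)"
    then have "\<omega> \<in> space (PiM {0..<Suc m} (\<lambda>_. S))" by (simp add: space_path_law[OF x])
    from nn_integral_eP[OF this f] show "(\<integral>\<^sup>+\<omega>'. f \<omega>' \<partial>eP (Suc m) \<omega>) = (\<integral>\<^sup>+y. f (fun_upd \<omega> (Suc m) y) \<partial>K (\<omega> m))"
      by (simp add: P_path_def)
  qed
  finally show ?thesis .
qed

text \<open>Markov property at time \<open>m\<close>: a functional \<open>F\<close> of the path up
  to time \<open>m\<close> is weighed against a function of the state \<open>s\<close> steps later,
  and the intermediate states are integrated out.\<close>

lemma nn_integral_path_law_step:
  assumes x: "x \<in> space S"
    and F: "F \<in> borel_measurable (PiM {0..<Suc m} (\<lambda>_. S))"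
    and G: "G \<in> borel_measurable S"
  shows "(\<integral>\<^sup>+\<omega>. F (restrict \<omega> {0..<Suc m}) * G (\<omega> (m + s)) \<partial>path_law x (m + s))
    = (\<integral>\<^sup>+\<omega>. F \<omega> * (\<integral>\<^sup>+y. G y \<partial>kernel_power S K s (\<omega> m)) \<partial>path_law x m)"
  using G
\<comment> \<open>Integrating out the last coordinate replaces \<open>G\<close> by its image under
  \<open>K\<close>, so \<open>G\<close> has to vary in the induction.\<close>
proof (induction s arbitrary: G)
  case 0
  have "F (restrict \<omega> {0..<Suc m}) * G (\<omega> m) = F \<omega> * (\<integral>\<^sup>+y. G y \<partial>kernel_power S K 0 (\<omega> m))"
    if "\<omega> \<in> space (path_law x m)" for \<omega>
  proof -
    have \<omega>: "\<omega> \<in> space (PiM {0..<Suc m} (\<lambda>_. S))"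
      using that by (simp add: space_path_law[OF x])
    then have "restrict \<omega> {0..<Suc m} = \<omega>" "\<omega> m \<in> space S"
      by (auto simp: space_PiM PiE_iff extensional_restrict)
    then show ?thesis
      using 0 by (simp add: nn_integral_return)
  qed
  then show ?case by (simp only: add_0_right) (rule nn_integral_cong)
next
  case (Suc s)
  note [measurable] = F Suc.prems
  have G' [measurable]: "(\<lambda>y. \<integral>\<^sup>+z. G z \<partial>K y) \<in> borel_measurable S"
    by (rule measurable_compose[OF kernel_subprob nn_integral_measurable_subprob_algebra]) fact
  have r: "(\<lambda>\<omega>. restrict \<omega> {0..<Suc m}) \<in> PiM {0..<Suc (Suc (m + s))} (\<lambda>_. S) \<rightarrow>\<^sub>M PiM {0..<Suc m} (\<lambda>_. S)"
    by (rule measurable_restrict_subset) auto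
  have 1: "(\<lambda>\<omega>. F (restrict \<omega> {0..<Suc m}) * G (\<omega> (Suc (m + s)))) \<in> borel_measurable (PiM {0..<Suc (Suc (m + s))} (\<lambda>_. S))"
    by (intro borel_measurable_times_ennreal measurable_compose[OF r F]
        measurable_compose[OF _ Suc.prems] measurable_component_singleton) auto
  have "(\<integral>\<^sup>+\<omega>. F (restrict \<omega> {0..<Suc m}) * G (\<omega> (m + Suc s)) \<partial>path_law x (m + Suc s))
      = (\<integral>\<^sup>+\<omega>. (\<integral>\<^sup>+y. F (restrict (fun_upd \<omega> (Suc (m + s)) y) {0..<Suc m}) * G y \<partial>K (\<omega> (m + s))) \<partial>path_law x (m + s))"
    using nn_integral_path_law_Suc[OF x 1] by simp
  also have "\<dots> = (\<integral>\<^sup>+\<omega>. F (restrict \<omega> {0..<Suc m}) * (\<integral>\<^sup>+z. G z \<partial>K (\<omega> (m + s))) \<partial>path_law x (m + s))"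
  proof (rule nn_integral_cong)
    fix \<omega> assume "\<omega> \<in> space (path_law x (m + s))"
    then have "\<omega> (m + s) \<in> space S"
      by (auto simp: space_path_law[OF x] space_PiM)
    then have "sets (K (\<omega> (m + s))) = sets S"
      using sets_kernel[OF kernel_subprob] by simp
    then have G: "G \<in> borel_measurable (K (\<omega> (m + s)))"
      using Suc.prems by (simp cong: measurable_cong_sets)
    have *: "restrict (fun_upd \<omega> (Suc (m + s)) y) {0..<Suc m} = restrict \<omega> {0..<Suc m}" for y
      by (auto simp: restrict_def)
    show "(\<integral>\<^sup>+y. F (restrict (fun_upd \<omega> (Suc (m + s)) y) {0..<Suc m}) * G y \<partial>K (\<omega> (m + s)))
        = F (restrict \<omega> {0..<Suc m}) * (\<integral>\<^sup>+z. G z \<partial>K (\<omega> (m + s)))"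
      unfolding * by (rule nn_integral_cmult[OF G])
  qed
  also have "\<dots> = (\<integral>\<^sup>+\<omega>. F \<omega> * (\<integral>\<^sup>+y. (\<integral>\<^sup>+z. G z \<partial>K y) \<partial>kernel_power S K s (\<omega> m)) \<partial>path_law x m)"
    by (rule Suc.IH[OF G'])
  also have "\<dots> = (\<integral>\<^sup>+\<omega>. F \<omega> * (\<integral>\<^sup>+y. G y \<partial>kernel_power S K (Suc s) (\<omega> m)) \<partial>path_law x m)"
  proof (rule nn_integral_cong)
    fix \<omega> assume "\<omega> \<in> space (path_law x m)"
    then have "\<omega> m \<in> space S"
      by (auto simp: space_path_law[OF x] space_PiM)
    from nn_integral_kernel_power_Suc[OF this Suc.prems]
    show "F \<omega> * (\<integral>\<^sup>+y. (\<integral>\<^sup>+z. G z \<partial>K y) \<partial>kernel_power S K s (\<omega> m)) = F \<omega> * (\<integral>\<^sup>+y. G y \<partial>kernel_power S K (Suc s) (\<omega> m))"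
      by simp
  qed
  finally show ?case .
qed

end

text \<open>Chapman-Kolmogorov equation. As \<open>kernel_power\<close> appends steps at the end,
  this is the way to split off the first step or a final stretch of several steps.\<close>

lemma (in markov_kernel) kernel_power_add:
  assumes x: "x \<in> space S"
  shows "kernel_power S K (i + j) x = kernel_power S K i x \<bind> kernel_power S K j"
proof (induction j)
  case 0
  have "kernel_power S K 0 = return S" by (rule ext) simp
  then show ?case using sets_kernel_power[OF x] by (simp only: bind_return'' add_0_right)
next
  case (Suc j)
  have K: "kernel_power S K j \<in> kernel_power S K i x \<rightarrow>\<^sub>M subprob_algebra S"
    using kernel_power_subprob[of j] sets_kernel_power[OF x] by (simp cong: measurable_cong_sets)
  have eq: "kernel_power S K (Suc j) = (\<lambda>x. kernel_power S K j x \<bind> K)" by (rule ext) simp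
  have "kernel_power S K i x \<bind> kernel_power S K (Suc j) = (kernel_power S K i x \<bind> kernel_power S K j) \<bind> K"
    unfolding eq by (rule bind_assoc[OF K kernel_subprob, symmetric])
  moreover have "kernel_power S K (i + Suc j) x = kernel_power S K (i + j) x \<bind> K"
    by simp
  ultimately show ?case by (simp only: Suc)
qed

lemma (in markov_kernel) validation_law_eq:
  "validation_law S K x n m
    = distr (path_law x m) (PiM {n + 1..n + m} (\<lambda>_. S)) (\<lambda>\<omega>. \<lambda>j\<in>{n + 1..n + m}. \<omega> (j - n))"
  by (simp only: validation_law_def path_law_def P_path_def[abs_def])

section \<open>Invariant laws\<close>

locale stationary_markov_kernel = markov_kernel +
  fixes Q
  assumes Q_space: "Q \<in> space (prob_algebra S)" and invariant: "Q \<bind> K = Q"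
begin

lemma sets_Q [measurable_cong]: "sets Q = sets S"
  and space_Q: "space Q = space S"
  using Q_space by (auto simp: space_prob_algebra dest: sets_eq_imp_space_eq)

sublocale Q: prob_space Q
  using Q_space by (simp add: space_prob_algebra)

lemma invariant_kernel_power: "Q \<bind> kernel_power S K n = Q"
proof (induction n)
  case 0
  have "kernel_power S K 0 = return S" by (rule ext) simp
  then show ?case
    using sets_Q by (simp add: bind_return'')
next
  case (Suc n)
  have K: "kernel_power S K n \<in> Q \<rightarrow>\<^sub>M subprob_algebra S"
    using kernel_power_subprob[of n] sets_Q by (simp cong: measurable_cong_sets)
  have "kernel_power S K (Suc n) = (\<lambda>x. kernel_power S K n x \<bind> K)" by (rule ext) simp
  then have "Q \<bind> kernel_power S K (Suc n) = (Q \<bind> kernel_power S K n) \<bind> K"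
    by (simp only: bind_assoc[OF K kernel_subprob])
  with Suc invariant show ?case by (simp only:)
qed

text \<open>Powers of the kernel keep a \<open>Q\<close>-centred function centred, which lets the
  contraction step below be iterated.\<close>

lemma integral_kernel_power:
  fixes f :: "'a \<Rightarrow> real"
  assumes "f \<in> borel_measurable S" "\<And>x. x \<in> space S \<Longrightarrow> \<bar>f x\<bar> \<le> B"
  shows "(\<integral>x. (\<integral>y. f y \<partial>kernel_power S K n x) \<partial>Q) = (\<integral>x. f x \<partial>Q)"
  using integral_bind_bounded[OF Q_space kernel_power_measurable assms, of n] invariant_kernel_power[of n]
  by simp

end

subsection \<open>Exponential moments under mixing\<close>

text \<open>Each index is written uniquely as \<open>r + l * t\<close> with \<open>r\<close> between
  1 and \<open>t\<close>. The hypothesis \<open>t <= m\<close> ensures \<open>r <= m\<close>;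
  otherwise the truncated difference \<open>m - r\<close> would produce a spurious term
  \<open>g r\<close>.\<close>

lemma sum_residue_classes:
  fixes g :: "nat \<Rightarrow> 'b::comm_monoid_add"
  assumes t: "1 \<le> t" "t \<le> m"
  shows "(\<Sum>j = 1..m. g j) = (\<Sum>r = 1..t. \<Sum>l \<le> (m - r) div t. g (r + l * t))"
proof -
  have "(\<Sum>r = 1..t. \<Sum>l \<le> (m - r) div t. g (r + l * t))
      = (\<Sum>(r, l) \<in> (SIGMA r:{1..t}. {..(m - r) div t}). g (r + l * t))"
    by (rule sum.Sigma) auto
  also have "\<dots> = (\<Sum>j = 1..m. g j)"
  \<comment> \<open>Residues run from 1 to \<open>t\<close>, so quotient and remainder are those of
    \<open>j - 1\<close>.\<close>
  proof (rule sum.reindex_bij_witness[where i = "\<lambda>j. (Suc ((j - 1) mod t), (j - 1) div t)"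
        and j = "\<lambda>(r, l). r + l * t"])
    fix a assume a: "a \<in> (SIGMA r:{1..t}. {..(m - r) div t})"
    then obtain r' l where rl': "a = (r', l)" "1 \<le> r'" "r' \<le> t" "l \<le> (m - r') div t"
      by (cases a) auto
    then obtain r where "r' = Suc r" by (cases r') auto
    with rl' have rl: "a = (Suc r, l)" "r < t" "l \<le> (m - Suc r) div t"
      by auto
    have "l * t \<le> (m - Suc r) div t * t" using rl(3) by simp
    also have "\<dots> \<le> m - Suc r" by simp
    finally have le: "l * t \<le> m - Suc r" .
    show "(Suc (((case a of (r, l) \<Rightarrow> r + l * t) - 1) mod t), ((case a of (r, l) \<Rightarrow> r + l * t) - 1) div t) = a"
      using rl by simp
    show "(case a of (r, l) \<Rightarrow> r + l * t) \<in> {1..m}"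
      using rl le t by simp
    show "g (case a of (r, l) \<Rightarrow> r + l * t) = (case a of (r, l) \<Rightarrow> g (r + l * t))"
      by (cases a) simp
  next
    fix j assume j: "j \<in> {1..m}"
    have e: "(j - 1) div t * t + (j - 1) mod t = j - 1" by simp
    show "(case (Suc ((j - 1) mod t), (j - 1) div t) of (r, l) \<Rightarrow> r + l * t) = j"
      using j e by (auto simp: algebra_simps)
    have "(j - 1) div t * t \<le> m - Suc ((j - 1) mod t)"
      using e j unfolding atLeastAtMost_iff by linarith
    then have "(j - 1) div t \<le> (m - Suc ((j - 1) mod t)) div t"
      using t by (simp add: less_eq_div_iff_mult_less_eq)
    moreover have "(j - 1) mod t < t" using t by simp
    ultimately show "(Suc ((j - 1) mod t), (j - 1) div t) \<in> (SIGMA r:{1..t}. {..(m - r) div t})"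
      by auto
  qed
  finally show ?thesis by simp
qed

text \<open>Jensen's inequality with equal weights: the sum is the mean of the values
  \<open>t * y r\<close>. This decouples the residue classes, however dependent they are, at the
  price of the factor \<open>t\<close> in the exponent.\<close>

lemma exp_mean_le:
  fixes y :: "nat \<Rightarrow> real"
  assumes "1 \<le> t"
  shows "exp (\<Sum>r = 1..t. y r) \<le> (\<Sum>r = 1..t. (1 / real t) * exp (real t * y r))"
proof -
  have "exp (\<Sum>r = 1..t. (1 / real t) *\<^sub>R (real t * y r)) \<le> (\<Sum>r = 1..t. (1 / real t) * exp (real t * y r))"
    using assms by (intro convex_on_sum[OF _ _ exp_convex]) auto
  then show ?thesis using assms by simp
qed

text \<open>Hoeffding's lemma for a variable that need not be centred: the factor
  \<open>exp (l * expectation g)\<close> is pulled out, and the lemma is applied to the centred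
  variable.\<close>

lemma (in prob_space) Hoeffding_mgf:
  fixes g :: "'a \<Rightarrow> real"
  assumes [measurable]: "g \<in> borel_measurable M"
    and g: "\<And>x. x \<in> space M \<Longrightarrow> a \<le> g x \<and> g x \<le> b" and l: "0 < l"
  shows "(\<integral>\<^sup>+x. ennreal (exp (l * g x)) \<partial>M) \<le> ennreal (exp (l * expectation g + l\<^sup>2 * (b - a)\<^sup>2 / 8))"
proof -
  interpret interval_bounded_random_variable M g a b
    by unfold_locales (use g in auto)
  have "(\<integral>\<^sup>+x. ennreal (exp (l * g x)) \<partial>M)
      = (\<integral>\<^sup>+x. ennreal (exp (l * expectation g)) * ennreal (exp (l * (g x - expectation g))) \<partial>M)"
    by (intro nn_integral_cong) (simp add: ennreal_mult[symmetric] exp_add[symmetric] algebra_simps)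
  also have "\<dots> = ennreal (exp (l * expectation g)) * (\<integral>\<^sup>+x. ennreal (exp (l * (g x - expectation g))) \<partial>M)"
    by (rule nn_integral_cmult) measurable
  also have "\<dots> \<le> ennreal (exp (l * expectation g)) * ennreal (exp (l\<^sup>2 * (b - a)\<^sup>2 / 8))"
    by (intro mult_left_mono Hoeffdings_lemma_nn_integral l) auto
  finally show ?thesis
    by (simp add: ennreal_mult[symmetric] exp_add[symmetric])
qed

section \<open>Contraction over one mixing time\<close>

locale mixing_markov_kernel = stationary_markov_kernel +
  fixes t :: nat
  assumes t_pos: "1 \<le> t"
    and mixing: "\<And>x. x \<in> space S \<Longrightarrow> d_TV (kernel_power S K t x) Q \<le> 1 / 4"
begin

text \<open>The bound \<open>1/2\<close> is the width 2 of the range times the distance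
  \<open>1/4\<close>. The constants reproduce themselves: a function of width 1 plus one bounded by
  \<open>1/2\<close> again has width at most 2. The term \<open>l^2 / 2\<close> is Hoeffding's
  \<open>l^2 * 2^2 / 8\<close>.\<close>

lemma mixing_step:
  fixes g :: "'a \<Rightarrow> real"
  assumes g [measurable]: "g \<in> borel_measurable S"
    and ga: "\<And>x. x \<in> space S \<Longrightarrow> a \<le> g x \<and> g x \<le> a + 2"
    and Qg: "(\<integral>x. g x \<partial>Q) = 0"
  defines "u \<equiv> \<lambda>x. \<integral>y. g y \<partial>kernel_power S K t x"
  shows "u \<in> borel_measurable S"
    and "\<And>x. x \<in> space S \<Longrightarrow> \<bar>u x\<bar> \<le> 1 / 2"
    and "(\<integral>x. u x \<partial>Q) = 0"
    and "\<And>x l. x \<in> space S \<Longrightarrow> 0 < l \<Longrightarrow>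
      (\<integral>\<^sup>+y. ennreal (exp (l * g y)) \<partial>kernel_power S K t x) \<le> ennreal (exp (l * u x + l\<^sup>2 / 2))"
proof -
  show "u \<in> borel_measurable S"
    unfolding u_def by measurable
  show "(\<integral>x. u x \<partial>Q) = 0"
  proof -
    have "\<bar>g x\<bar> \<le> max \<bar>a\<bar> \<bar>a + 2\<bar>" if "x \<in> space S" for x
      using ga[OF that] by auto
    from integral_kernel_power[OF g this] Qg show ?thesis by (simp add: u_def)
  qed
  fix x assume x: "x \<in> space S"
  interpret X: prob_space "kernel_power S K t x" by (rule prob_space_kernel_power[OF x])
  have g' [measurable]: "g \<in> borel_measurable (kernel_power S K t x)"
    using g sets_kernel_power[OF x] by (simp cong: measurable_cong_sets)
  show "\<bar>u x\<bar> \<le> 1 / 2"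
  proof -
    have "\<bar>(\<integral>y. g y \<partial>kernel_power S K t x) - (\<integral>y. g y \<partial>Q)\<bar> \<le> 2 * d_TV (kernel_power S K t x) Q"
      by (rule d_TV_integral[where a = a])
        (use ga g' sets_Q sets_kernel_power[OF x] space_kernel_power[OF x] in
          \<open>auto intro: Q.prob_space_axioms X.prob_space_axioms\<close>)
    with mixing[OF x] Qg show ?thesis by (simp add: u_def)
  qed
  fix l :: real assume l: "0 < l"
  have "l\<^sup>2 * (a + 2 - a)\<^sup>2 / 8 = l\<^sup>2 / 2" by simp
  with X.Hoeffding_mgf[OF g' _ l, of a "a + 2"] ga space_kernel_power[OF x]
  show "(\<integral>\<^sup>+y. ennreal (exp (l * g y)) \<partial>kernel_power S K t x) \<le> ennreal (exp (l * u x + l\<^sup>2 / 2))"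
    by (simp add: u_def)
qed

context
  fixes f :: "'a \<Rightarrow> real" and a :: real and x :: 'a
  assumes f [measurable]: "f \<in> borel_measurable S"
    and fa: "\<And>y. y \<in> space S \<Longrightarrow> a \<le> f y \<and> f y \<le> a + 1" and a: "- 1 \<le> a" "a \<le> 0"
    and Qf: "(\<integral>y. f y \<partial>Q) = 0"
    and x: "x \<in> space S"
begin

text \<open>
  The term \<open>h\<close> is the conditional mean of the later summands: without it the induction, which
  removes the last summand, would not go through.
\<close>

lemma mgf_skeleton:
  assumes "h \<in> borel_measurable S" "\<And>y. y \<in> space S \<Longrightarrow> \<bar>h y\<bar> \<le> 1 / 2" "(\<integral>y. h y \<partial>Q) = 0"
    and l: "0 < l"
  shows "(\<integral>\<^sup>+\<omega>. ennreal (exp (l * ((\<Sum>i\<le>n. f (\<omega> (r + i * t))) + h (\<omega> (r + n * t))))) \<partial>path_law x (r + n * t))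
    \<le> ennreal (exp (2 * l + real n * l\<^sup>2 / 2))"
  using assms(1-3)
proof (induction n arbitrary: h)
  case 0
  interpret P: prob_space "path_law x r" by (rule prob_space_path_law[OF x])
  have "(\<integral>\<^sup>+\<omega>. ennreal (exp (l * (f (\<omega> r) + h (\<omega> r)))) \<partial>path_law x r)
      \<le> (\<integral>\<^sup>+\<omega>. ennreal (exp (2 * l)) \<partial>path_law x r)"
  proof (rule nn_integral_mono)
    fix \<omega> assume "\<omega> \<in> space (path_law x r)"
    then have "\<omega> r \<in> space S" by (auto simp: space_path_law[OF x] space_PiM)
    \<comment> \<open>The law of the first state met by the sum is not controlled, so this summand
      is bounded crudely: \<open>f <= 1\<close> by \<open>a <= 0\<close>, and
      \<open>h <= 1/2\<close>. This is the source of the term \<open>2 * l\<close>.\<close>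
    then have "f (\<omega> r) + h (\<omega> r) \<le> 2" using fa[of "\<omega> r"] 0(2)[of "\<omega> r"] a by auto
    then show "ennreal (exp (l * (f (\<omega> r) + h (\<omega> r)))) \<le> ennreal (exp (2 * l))"
      using l by (simp add: mult.commute[of 2])
  qed
  then show ?case by (simp add: P.emeasure_space_1)
next
  case (Suc n)
  note [measurable] = Suc.prems(1)
  define m where "m = r + n * t"
  \<comment> \<open>The last summand together with the correction \<open>h\<close>: the range has
    width at most \<open>1 + 2 * (1/2)\<close>, as \<open>mixing_step\<close> demands.\<close>
  define g where "g y = f y + h y" for y
  define u where "u y = (\<integral>z. g z \<partial>kernel_power S K t y)" for y
  have g [measurable]: "g \<in> borel_measurable S" by (simp add: g_def[abs_def])
  have ga: "a - 1 / 2 \<le> g y \<and> g y \<le> a - 1 / 2 + 2" if "y \<in> space S" for y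
    using fa[OF that] Suc.prems(2)[OF that] by (auto simp: g_def abs_le_iff)
  have i: "integrable Q f" "integrable Q h"
    using fa a Suc.prems(2) f Suc.prems(1) by (auto intro!: Q.integrable_const_bound[where B = 1] AE_I2
      simp: space_Q abs_le_iff cong: measurable_cong_sets) force+
  have Qg: "(\<integral>y. g y \<partial>Q) = 0"
    unfolding g_def using i by (simp add: Qf Suc.prems(3))
  note step = mixing_step[OF g ga Qg, folded u_def]
  define F where "F \<omega> = ennreal (exp (l * (\<Sum>i\<le>n. f (\<omega> (r + i * t)))))" for \<omega>
  have F: "F \<in> borel_measurable (PiM {0..<Suc m} (\<lambda>_. S))"
  proof -
    have "(\<lambda>\<omega>. \<Sum>i\<le>n. f (\<omega> (r + i * t))) \<in> borel_measurable (PiM {0..<Suc m} (\<lambda>_. S))"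
      by (intro borel_measurable_sum measurable_compose[OF _ f] measurable_component_singleton)
        (auto simp: m_def less_Suc_eq_le)
    then show ?thesis unfolding F_def[abs_def] by measurable
  qed
  \<comment> \<open>All indices in \<open>F\<close> are at most \<open>m\<close>, so
    \<open>F\<close> is a functional of the path up to time \<open>m\<close> and the Markov property
    applies.\<close>
  have F_restrict: "F (restrict \<omega> {0..<Suc m}) = F \<omega>" for \<omega>
  proof -
    have "r + i * t < Suc m" if "i \<le> n" for i
      using that by (simp add: m_def less_Suc_eq_le)
    then show ?thesis unfolding F_def by (auto intro!: sum.cong)
  qed
  have "(\<integral>\<^sup>+\<omega>. ennreal (exp (l * ((\<Sum>i\<le>Suc n. f (\<omega> (r + i * t))) + h (\<omega> (r + Suc n * t))))) \<partial>path_law x (r + Suc n * t))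
      = (\<integral>\<^sup>+\<omega>. F (restrict \<omega> {0..<Suc m}) * ennreal (exp (l * g (\<omega> (m + t)))) \<partial>path_law x (m + t))"
    unfolding F_restrict
    by (simp add: F_def g_def m_def ennreal_mult[symmetric] exp_add[symmetric] algebra_simps)
  also have "\<dots> = (\<integral>\<^sup>+\<omega>. F \<omega> * (\<integral>\<^sup>+y. ennreal (exp (l * g y)) \<partial>kernel_power S K t (\<omega> m)) \<partial>path_law x m)"
    by (rule nn_integral_path_law_step[OF x F]) measurable
  also have "\<dots> \<le> (\<integral>\<^sup>+\<omega>. F \<omega> * ennreal (exp (l * u (\<omega> m) + l\<^sup>2 / 2)) \<partial>path_law x m)"
    by (intro nn_integral_mono mult_left_mono step(4) l) (auto simp: space_path_law[OF x] space_PiM)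
  also have "\<dots> = (\<integral>\<^sup>+\<omega>. ennreal (exp (l\<^sup>2 / 2)) *
      ennreal (exp (l * ((\<Sum>i\<le>n. f (\<omega> (r + i * t))) + u (\<omega> (r + n * t))))) \<partial>path_law x (r + n * t))"
    by (simp add: F_def m_def ennreal_mult[symmetric] exp_add[symmetric] algebra_simps)
  also have "\<dots> = ennreal (exp (l\<^sup>2 / 2)) * (\<integral>\<^sup>+\<omega>.
      ennreal (exp (l * ((\<Sum>i\<le>n. f (\<omega> (r + i * t))) + u (\<omega> (r + n * t))))) \<partial>path_law x (r + n * t))"
  proof (rule nn_integral_cmult)
    have 1: "(\<lambda>\<omega>. \<Sum>i\<le>n. f (\<omega> (r + i * t))) \<in> borel_measurable (path_law x (r + n * t))"
      unfolding measurable_cong_sets[OF sets_path_law[OF x] refl]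
      by (intro borel_measurable_sum measurable_compose[OF _ f] measurable_component_singleton)
        (auto simp: less_Suc_eq_le)
    have 2: "(\<lambda>\<omega>. u (\<omega> (r + n * t))) \<in> borel_measurable (path_law x (r + n * t))"
      unfolding measurable_cong_sets[OF sets_path_law[OF x] refl]
      by (intro measurable_compose[OF _ step(1)] measurable_component_singleton) auto
    show "(\<lambda>\<omega>. ennreal (exp (l * ((\<Sum>i\<le>n. f (\<omega> (r + i * t))) + u (\<omega> (r + n * t))))))
        \<in> borel_measurable (path_law x (r + n * t))"
      using 1 2 by measurable
  qed
  \<comment> \<open>The induction hypothesis is used with \<open>u\<close> in place of
    \<open>h\<close>; \<open>mixing_step\<close> provides exactly its three requirements.\<close>
  also have "\<dots> \<le> ennreal (exp (l\<^sup>2 / 2)) * ennreal (exp (2 * l + real n * l\<^sup>2 / 2))"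
    by (intro mult_left_mono Suc.IH step(1-3)) auto
  also have "\<dots> = ennreal (exp (2 * l + real (Suc n) * l\<^sup>2 / 2))"
    by (simp add: ennreal_mult[symmetric] exp_add[symmetric] algebra_simps add_divide_distrib)
  finally show ?case .
qed

text \<open>The case \<open>h = 0\<close> of \<open>mgf_skeleton\<close>, on a path that may extend
  beyond the last index \<open>r + n * t\<close>: the remaining coordinates integrate to 1.\<close>

lemma mgf_residue_class:
  assumes l: "0 < l" and m: "r + n * t \<le> m"
  shows "(\<integral>\<^sup>+\<omega>. ennreal (exp (l * (\<Sum>i\<le>n. f (\<omega> (r + i * t))))) \<partial>path_law x m)
    \<le> ennreal (exp (2 * l + real n * l\<^sup>2 / 2))"
proof -
  define k where "k = r + n * t"
  obtain s where s: "m = k + s" using m by (auto simp: k_def le_iff_add)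
  define F where "F \<omega> = ennreal (exp (l * (\<Sum>i\<le>n. f (\<omega> (r + i * t)))))" for \<omega>
  have F: "F \<in> borel_measurable (PiM {0..<Suc k} (\<lambda>_. S))"
  proof -
    have "(\<lambda>\<omega>. \<Sum>i\<le>n. f (\<omega> (r + i * t))) \<in> borel_measurable (PiM {0..<Suc k} (\<lambda>_. S))"
      by (intro borel_measurable_sum measurable_compose[OF _ f] measurable_component_singleton)
        (auto simp: k_def less_Suc_eq_le)
    then show ?thesis unfolding F_def[abs_def] by measurable
  qed
  have F_restrict: "F (restrict \<omega> {0..<Suc k}) = F \<omega>" for \<omega>
  proof -
    have "r + i * t < Suc k" if "i \<le> n" for i
      using that by (simp add: k_def less_Suc_eq_le)
    then show ?thesis unfolding F_def by (auto intro!: sum.cong)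
  qed
  have "(\<integral>\<^sup>+\<omega>. ennreal (exp (l * (\<Sum>i\<le>n. f (\<omega> (r + i * t))))) \<partial>path_law x m)
      = (\<integral>\<^sup>+\<omega>. F (restrict \<omega> {0..<Suc k}) * 1 \<partial>path_law x (k + s))"
    unfolding F_restrict by (simp add: F_def s)
  also have "\<dots> = (\<integral>\<^sup>+\<omega>. F \<omega> * (\<integral>\<^sup>+y. 1 \<partial>kernel_power S K s (\<omega> k)) \<partial>path_law x k)"
    by (rule nn_integral_path_law_step[OF x F]) measurable
  also have "\<dots> = (\<integral>\<^sup>+\<omega>. F \<omega> \<partial>path_law x k)"
  proof (rule nn_integral_cong)
    fix \<omega> assume "\<omega> \<in> space (path_law x k)"
    then have "\<omega> k \<in> space S" by (auto simp: space_path_law[OF x] space_PiM)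
    then show "F \<omega> * (\<integral>\<^sup>+y. 1 \<partial>kernel_power S K s (\<omega> k)) = F \<omega>"
      using prob_space.emeasure_space_1[OF prob_space_kernel_power] by simp
  qed
  also have "\<dots> \<le> ennreal (exp (2 * l + real n * l\<^sup>2 / 2))"
    using mgf_skeleton[of "\<lambda>_. 0" l r n] l by (simp add: F_def k_def)
  finally show ?thesis .
qed

text \<open>By convexity the left side is at most the average over the \<open>t\<close> residue
  classes of their generating functions at \<open>l * t\<close>, and each of these obeys the same
  bound.\<close>

lemma mgf_path_sum:
  assumes l: "0 < l" and m: "t \<le> m"
  shows "(\<integral>\<^sup>+\<omega>. ennreal (exp (l * (\<Sum>j = 1..m. f (\<omega> j)))) \<partial>path_law x m)
    \<le> ennreal (exp (2 * l * real t + l\<^sup>2 * real t * real m / 2))"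
proof -
  define B where "B = exp (2 * l * real t + l\<^sup>2 * real t * real m / 2)"
  have tp: "0 < t" using t_pos by simp
  have "(\<integral>\<^sup>+\<omega>. ennreal (exp (l * (\<Sum>j = 1..m. f (\<omega> j)))) \<partial>path_law x m)
      \<le> (\<integral>\<^sup>+\<omega>. (\<Sum>r = 1..t. ennreal (1 / real t) *
            ennreal (exp (l * real t * (\<Sum>i\<le>(m - r) div t. f (\<omega> (r + i * t)))))) \<partial>path_law x m)"
  proof (rule nn_integral_mono)
    fix \<omega>
    have "l * (\<Sum>j = 1..m. f (\<omega> j)) = (\<Sum>r = 1..t. l * (\<Sum>i\<le>(m - r) div t. f (\<omega> (r + i * t))))"
      by (simp only: sum_residue_classes[OF t_pos m, of "\<lambda>j. f (\<omega> j)"] sum_distrib_left[symmetric])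
    then have "exp (l * (\<Sum>j = 1..m. f (\<omega> j)))
        \<le> (\<Sum>r = 1..t. (1 / real t) * exp (l * real t * (\<Sum>i\<le>(m - r) div t. f (\<omega> (r + i * t)))))"
      using exp_mean_le[OF t_pos, of "\<lambda>r. l * (\<Sum>i\<le>(m - r) div t. f (\<omega> (r + i * t)))"]
      by (simp add: mult_ac)
    then show "ennreal (exp (l * (\<Sum>j = 1..m. f (\<omega> j))))
        \<le> (\<Sum>r = 1..t. ennreal (1 / real t) * ennreal (exp (l * real t * (\<Sum>i\<le>(m - r) div t. f (\<omega> (r + i * t))))))"
      by (auto simp: ennreal_mult[symmetric] sum_ennreal simp del: times_divide_eq_left mult_1_left intro!: ennreal_leI)
  qed
  also have "\<dots> = (\<Sum>r = 1..t. ennreal (1 / real t) *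
      (\<integral>\<^sup>+\<omega>. ennreal (exp (l * real t * (\<Sum>i\<le>(m - r) div t. f (\<omega> (r + i * t))))) \<partial>path_law x m))"
  proof -
    have M: "(\<lambda>\<omega>. ennreal (exp (l * real t * (\<Sum>i\<le>(m - r) div t. f (\<omega> (r + i * t))))))
        \<in> borel_measurable (path_law x m)" if r: "r \<in> {1..t}" for r
    proof -
      have "r + i * t \<in> {0..<Suc m}" if "i \<le> (m - r) div t" for i
      proof -
        have "i * t \<le> (m - r) div t * t" using that by simp
        also have "\<dots> \<le> m - r" by simp
        finally show ?thesis using r m by auto
      qed
      then have "(\<lambda>\<omega>. \<Sum>i\<le>(m - r) div t. f (\<omega> (r + i * t))) \<in> borel_measurable (path_law x m)"
        unfolding measurable_cong_sets[OF sets_path_law[OF x] refl]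
        by (intro borel_measurable_sum measurable_compose[OF _ f] measurable_component_singleton) auto
      then show ?thesis by measurable
    qed
    show ?thesis
      using M by (subst nn_integral_sum) (auto simp: nn_integral_cmult intro!: sum.cong)
  qed
  also have "\<dots> \<le> (\<Sum>r = 1..t. ennreal (1 / real t) * ennreal B)"
  proof (intro sum_mono mult_left_mono)
    fix r assume r: "r \<in> {1..t}"
    have "(m - r) div t * t \<le> m - r" "r \<le> m" using r m by auto
    then have rm: "r + (m - r) div t * t \<le> m" by linarith
    \<comment> \<open>A class contains about \<open>m / t\<close> indices, so one of the two factors
      \<open>t\<close> in \<open>(l * t)^2\<close> is absorbed and the exponent is linear in
      \<open>t\<close>.\<close>
    have "real ((m - r) div t) * real t \<le> real m"
      using rm by (simp flip: of_nat_mult)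
    then have "real ((m - r) div t) * real t * (l\<^sup>2 * real t) \<le> real m * (l\<^sup>2 * real t)"
      by (intro mult_right_mono) auto
    then have "exp (2 * (l * real t) + real ((m - r) div t) * (l * real t)\<^sup>2 / 2) \<le> B"
      unfolding B_def by (simp add: power2_eq_square mult_ac)
    then show "(\<integral>\<^sup>+\<omega>. ennreal (exp (l * real t * (\<Sum>i\<le>(m - r) div t. f (\<omega> (r + i * t))))) \<partial>path_law x m) \<le> ennreal B"
      using mgf_residue_class[OF _ rm, of "l * real t"] l tp
      by (meson ennreal_leI mult_pos_pos of_nat_0_less_iff order.trans)
  qed auto
  also have "\<dots> = ennreal B"
    using tp by (simp add: B_def ennreal_mult[symmetric] ennreal_of_nat_eq_real_of_nat)
  finally show ?thesis by (simp add: B_def)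
qed

end

end

subsection \<open>Selection by the empirical mean\<close>

context mixing_markov_kernel
begin

context
  fixes f :: "nat \<Rightarrow> 'a \<Rightarrow> real" and sel :: "(nat \<Rightarrow> 'a) \<Rightarrow> nat" and N m b :: nat and x :: 'a
  assumes f: "\<And>k. k \<in> {1..N} \<Longrightarrow> f k \<in> borel_measurable S"
    and f01: "\<And>k y. k \<in> {1..N} \<Longrightarrow> y \<in> space S \<Longrightarrow> 0 \<le> f k y \<and> f k y \<le> 1"
    and x: "x \<in> space S" and m: "1 \<le> m"
    and sel [measurable]: "sel \<in> path_law x m \<rightarrow>\<^sub>M count_space UNIV"
    and sel_range: "\<And>\<omega>. \<omega> \<in> space (path_law x m) \<Longrightarrow> sel \<omega> \<in> {1..N}"
    and sel_min: "\<And>\<omega>. \<omega> \<in> space (path_law x m) \<Longrightarrow>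
      (\<Sum>j = 1..m. f (sel \<omega>) (\<omega> j)) \<le> (\<Sum>j = 1..m. f b (\<omega> j))"
    and b: "b \<in> {1..N}"
begin

lemma mean_in_unit:
  assumes k: "k \<in> {1..N}"
  shows "0 \<le> (\<integral>y. f k y \<partial>Q) \<and> (\<integral>y. f k y \<partial>Q) \<le> 1"
proof -
  have [measurable]: "f k \<in> borel_measurable Q"
    using f[OF k] sets_Q by (simp cong: measurable_cong_sets)
  have i: "integrable Q (f k)"
    by (rule Q.integrable_const_bound[where B = 1]) (use f01[OF k] space_Q in auto)
  have "(\<integral>y. f k y \<partial>Q) \<le> (\<integral>y. 1 \<partial>Q)"
    using i f01[OF k] space_Q by (intro integral_mono) auto
  moreover have "0 \<le> (\<integral>y. f k y \<partial>Q)"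
    using f01[OF k] space_Q by (intro integral_nonneg_AE AE_I2) auto
  ultimately show ?thesis by (simp add: Q.prob_space)
qed

text \<open>The sign \<open>s\<close> covers both directions: upper deviations are needed for every
  candidate, since the selected index is random, and a lower one for the fixed competitor.\<close>

lemma mgf_deviation:
  assumes k: "k \<in> {1..N}" and l: "0 < l" and tm: "t \<le> m" and s: "s \<in> {- 1, 1}"
  defines "Z \<equiv> \<lambda>\<omega>. exp (l * (s * (\<Sum>j = 1..m. (\<integral>y. f k y \<partial>Q) - f k (\<omega> j))))"
  shows "integrable (path_law x m) Z"
    and "(\<integral>\<omega>. Z \<omega> \<partial>path_law x m) \<le> exp (2 * l * real t + l\<^sup>2 * real t * real m / 2)"
proof -
  interpret P: prob_space "path_law x m" by (rule prob_space_path_law[OF x])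
  note fk = f[OF k]
  define q where "q = (\<integral>y. f k y \<partial>Q)"
  have q: "0 \<le> q" "q \<le> 1" using mean_in_unit[OF k] by (auto simp: q_def)
  define g where "g y = s * (q - f k y)" for y
  \<comment> \<open>Left end of the range of \<open>g\<close>: \<open>q - f k\<close> lies in
    \<open>[q - 1, q]\<close> and \<open>f k - q\<close> in \<open>[- q, 1 - q]\<close>. Both left
    ends lie in \<open>[-1, 0]\<close> because \<open>q\<close> is in the unit interval.\<close>
  define a where "a = (if s = 1 then q - 1 else - q)"
  have g [measurable]: "g \<in> borel_measurable S"
    using fk unfolding g_def[abs_def] by measurable
  have ga: "a \<le> g y \<and> g y \<le> a + 1" if "y \<in> space S" for y
    using f01[OF k that] s by (auto simp: g_def a_def)
  have "integrable Q (f k)"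
    by (rule Q.integrable_const_bound[where B = 1])
      (use f01[OF k] fk space_Q sets_Q in \<open>auto cong: measurable_cong_sets\<close>)
  then have Qg: "(\<integral>y. g y \<partial>Q) = 0"
    by (simp add: g_def q_def Q.prob_space)
  have Z: "Z = (\<lambda>\<omega>. exp (l * (\<Sum>j = 1..m. g (\<omega> j))))"
    by (simp add: Z_def g_def q_def sum_distrib_left)
  have meas: "(\<lambda>\<omega>. \<Sum>j = 1..m. g (\<omega> j)) \<in> borel_measurable (path_law x m)"
    unfolding measurable_cong_sets[OF sets_path_law[OF x] refl]
    by (intro borel_measurable_sum measurable_compose[OF _ g] measurable_component_singleton) auto
  have "a \<ge> - 1" "a \<le> 0" using q by (auto simp: a_def)
  note mgf = mgf_path_sum[OF g ga this Qg x l tm]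
  show "integrable (path_law x m) Z"
  proof (rule integrableI_nonneg)
    show "Z \<in> borel_measurable (path_law x m)" unfolding Z using meas by measurable
    show "(\<integral>\<^sup>+\<omega>. ennreal (Z \<omega>) \<partial>path_law x m) < \<infinity>"
      unfolding Z by (rule order.strict_trans1[OF mgf], assumption) (unfold infinity_ennreal_def, rule ennreal_less_top)
  qed (simp add: Z)
  show "(\<integral>\<omega>. Z \<omega> \<partial>path_law x m) \<le> exp (2 * l * real t + l\<^sup>2 * real t * real m / 2)"
    unfolding Z by (rule integral_real_bounded[OF _ mgf]) simp
qed

lemma integrable_selected_excess:
  "integrable (path_law x m) (\<lambda>\<omega>. (\<integral>y. f (sel \<omega>) y \<partial>Q) - c)"
proof -
  interpret P: prob_space "path_law x m" by (rule prob_space_path_law[OF x])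
  have "integrable (path_law x m) (\<lambda>\<omega>. \<integral>y. f (sel \<omega>) y \<partial>Q)"
  proof (rule P.integrable_const_bound[where B = 1])
    show "AE \<omega> in path_law x m. norm (\<integral>y. f (sel \<omega>) y \<partial>Q) \<le> 1"
      using mean_in_unit sel_range by (intro AE_I2) fastforce
    show "(\<lambda>\<omega>. \<integral>y. f (sel \<omega>) y \<partial>Q) \<in> borel_measurable (path_law x m)"
      by (rule measurable_compose[OF sel]) simp
  qed
  then show ?thesis by simp
qed

text \<open>Since \<open>sel\<close> does at least as well as \<open>b\<close> on the sample,
  \<open>m\<close> times its excess is at most the difference of the two centred deviations. The one
  at the random index is controlled by a sum of exponentials over all candidates, which costs
  \<open>ln N\<close>; each deviation costs one \<open>c\<close>.\<close>

lemma selection_exp_bound: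
  assumes l: "0 < l" and tm: "t \<le> m"
  shows "l * (real m * (\<integral>\<omega>. (\<integral>y. f (sel \<omega>) y \<partial>Q) - (\<integral>y. f b y \<partial>Q) \<partial>path_law x m))
    \<le> ln (real N) + 4 * l * real t + l\<^sup>2 * real t * real m"
proof -
  interpret P: prob_space "path_law x m" by (rule prob_space_path_law[OF x])
  define q where "q k = (\<integral>y. f k y \<partial>Q)" for k
  define c where "c = 2 * l * real t + l\<^sup>2 * real t * real m / 2"
  define Z where "Z k s \<omega> = exp (l * (s * (\<Sum>j = 1..m. q k - f k (\<omega> j))))" for k s \<omega>
  have N: "1 \<le> N" using b by auto
  have Zi: "integrable (path_law x m) (Z k s)" and ZE: "(\<integral>\<omega>. Z k s \<omega> \<partial>path_law x m) \<le> exp c"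
    if "k \<in> {1..N}" "s \<in> {- 1, 1}" for k s
    using mgf_deviation[OF that(1) l tm that(2)] by (simp_all add: Z_def[abs_def] q_def c_def)
  \<comment> \<open>An integrable majorant from the tangent inequality
    \<open>z <= exp z - 1\<close>. The shifts \<open>ln N + c\<close> and \<open>c\<close> normalize
    the two fractions to have mean at most 1, which cancels the \<open>- 2\<close>.\<close>
  define R where "R \<omega> = ln (real N) + 2 * c - 2 + (\<Sum>k = 1..N. Z k 1 \<omega>) / (real N * exp c) + Z b (- 1) \<omega> / exp c" for \<omega>
  have Ri: "integrable (path_law x m) R"
    unfolding R_def[abs_def]
    by (intro Bochner_Integration.integrable_add integrable_divide Bochner_Integration.integrable_sum P.integrable_const Zi) (use b in auto)
  have bound: "l * (real m * (q (sel \<omega>) - q b)) \<le> R \<omega>" if \<omega>: "\<omega> \<in> space (path_law x m)" for \<omega>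
  proof -
    define d where "d k = (\<Sum>j = 1..m. q k - f k (\<omega> j))" for k
    have "real m * (q (sel \<omega>) - q b) \<le> d (sel \<omega>) - d b"
      using sel_min[OF \<omega>] by (simp add: d_def sum_subtractf algebra_simps)
    then have 1: "l * (real m * (q (sel \<omega>) - q b)) \<le> l * d (sel \<omega>) - l * d b"
      using l by (simp add: right_diff_distrib[symmetric] mult_left_mono)
    have "l * d (sel \<omega>) - (ln (real N) + c) \<le> exp (l * d (sel \<omega>) - (ln (real N) + c)) - 1"
      using exp_ge_add_one_self[of "l * d (sel \<omega>) - (ln (real N) + c)"] by linarith
    also have "exp (l * d (sel \<omega>) - (ln (real N) + c)) = Z (sel \<omega>) 1 \<omega> / (real N * exp c)"
      using N by (simp add: exp_diff exp_add Z_def d_def)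
    \<comment> \<open>Union bound: the term at the selected index is one of the nonnegative terms of
      the sum.\<close>
    also have "\<dots> \<le> (\<Sum>k = 1..N. Z k 1 \<omega>) / (real N * exp c)"
      using sel_range[OF \<omega>] by (intro divide_right_mono member_le_sum) (auto simp: Z_def)
    finally have 2: "l * d (sel \<omega>) \<le> ln (real N) + c - 1 + (\<Sum>k = 1..N. Z k 1 \<omega>) / (real N * exp c)"
      by simp
    have "- (l * d b) - c \<le> exp (- (l * d b) - c) - 1"
      using exp_ge_add_one_self[of "- (l * d b) - c"] by linarith
    also have "exp (- (l * d b) - c) = Z b (- 1) \<omega> / exp c"
      by (simp add: exp_diff Z_def d_def)
    finally show ?thesis using 1 2 by (simp add: R_def)
  qed
  have "l * (real m * (\<integral>\<omega>. q (sel \<omega>) - q b \<partial>path_law x m)) = (\<integral>\<omega>. l * (real m * (q (sel \<omega>) - q b)) \<partial>path_law x m)"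
    by simp
  also have "\<dots> \<le> (\<integral>\<omega>. R \<omega> \<partial>path_law x m)"
    using integrable_selected_excess[of "q b"] Ri bound unfolding q_def
    by (intro integral_mono integrable_mult_right) auto
  also have "\<dots> = ln (real N) + 2 * c - 2 + (\<Sum>k = 1..N. \<integral>\<omega>. Z k 1 \<omega> \<partial>path_law x m) / (real N * exp c)
      + (\<integral>\<omega>. Z b (- 1) \<omega> \<partial>path_law x m) / exp c"
  proof -
    have "integrable (path_law x m) (\<lambda>\<omega>. \<Sum>k = 1..N. Z k 1 \<omega>)" "integrable (path_law x m) (Z b (- 1))"
      using b by (auto intro!: Bochner_Integration.integrable_sum Zi)
    moreover have "(\<integral>\<omega>. (\<Sum>k = 1..N. Z k 1 \<omega>) \<partial>path_law x m) = (\<Sum>k = 1..N. \<integral>\<omega>. Z k 1 \<omega> \<partial>path_law x m)"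
      by (intro Bochner_Integration.integral_sum Zi) auto
    ultimately show ?thesis
      unfolding R_def[abs_def] by (simp add: P.prob_space)
  qed
  also have "\<dots> \<le> ln (real N) + 2 * c - 2 + (\<Sum>k = 1..N. exp c) / (real N * exp c) + exp c / exp c"
    using ZE b by (intro add_mono divide_right_mono sum_mono order.refl) auto
  also have "\<dots> = ln (real N) + 2 * c"
    using N by simp
  finally show ?thesis by (simp add: q_def c_def)
qed

text \<open>Optimization over \<open>l\<close>. With \<open>r = t / m\<close> and
  \<open>w = sqrt (B * r)\<close> the exponential bound becomes \<open>2 * w + 4 * r\<close>, and
  \<open>r <= w\<close> gives \<open>6 * w\<close>.\<close>

lemma selection_excess_bound:
  assumes B: "1 + ln (real N) \<le> B"
  shows "(\<integral>\<omega>. (\<integral>y. f (sel \<omega>) y \<partial>Q) - (\<integral>y. f b y \<partial>Q) \<partial>path_law x m) \<le> 6 * sqrt (B * (real t / real m))"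
    (is "?E \<le> _")
proof -
  interpret P: prob_space "path_law x m" by (rule prob_space_path_law[OF x])
  define r where "r = real t / real m"
  have N: "1 \<le> N" using b by auto
  then have "0 \<le> ln (real N)" by (intro ln_ge_zero) simp
  with B have B1: "1 \<le> B" by linarith
  have r0: "0 < r" using t_pos m by (simp add: r_def)
  show ?thesis
  proof (cases "t \<le> m")
    \<comment> \<open>With fewer observations than one mixing time, the right-hand side is already
      at least 1, while the excess is at most 1.\<close>
    case False
    then have "1 \<le> r" using m by (simp add: r_def)
    then have "1 \<le> B * r" using B1 mult_mono[of 1 B 1 r] by simp
    then have "1 \<le> sqrt (B * r)" by simp
    moreover have "?E \<le> (\<integral>\<omega>. 1 \<partial>path_law x m)"
      using integrable_selected_excess mean_in_unit[OF b] mean_in_unit[OF sel_range]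
      by (intro integral_mono) fastforce+
    ultimately show ?thesis unfolding r_def using lebesgue_integral_const[of "path_law x m" "1::real"] P.prob_space by (simp only: scaleR_one)
  next
    case True
    then have r1: "r \<le> 1" using m by (simp add: r_def)
    define w where "w = sqrt (B * r)"
    have w0: "0 < w" using B1 r0 by (simp add: w_def)
    have w2: "w * w = B * r" using B1 r0 by (simp add: w_def)
    \<comment> \<open>This choice makes \<open>B\<close> and \<open>l^2 * t * m\<close> equal, both
      being \<open>l * m * w\<close>.\<close>
    define l where "l = w / real t"
    have tp: "0 < real t" and mp: "0 < real m" using t_pos m by auto
    have l0: "0 < l" using w0 tp by (simp add: l_def)
    have Bl: "B = w * real m * l"
      using w2 tp mp by (simp add: l_def r_def field_simps)
    have "l * (real m * ?E) \<le> B + 4 * l * real t + l\<^sup>2 * real t * real m"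
      using selection_exp_bound[OF l0 True] B by linarith
    also have "\<dots> = l * (real m * (w + 4 * r + w))"
      unfolding Bl using tp mp by (simp add: r_def power2_eq_square l_def field_simps)
    finally have "?E \<le> 2 * w + 4 * r"
      using l0 mp by simp
    moreover have "r \<le> w"
    proof -
      \<comment> \<open>Here \<open>r <= 1 <= B\<close>, so the linear term is absorbed by the
        square root.\<close>
      have "r * r \<le> B * r" using r1 B1 r0 by (intro mult_right_mono) auto
      then show ?thesis unfolding w_def using r0 by (intro real_le_rsqrt) (simp add: power2_eq_square)
    qed
    ultimately show ?thesis by (simp add: w_def r_def)
  qed
qed

end

end

subsection \<open>Blocks of a chain of higher order\<close>

text \<open>The update map inside \<open>block_kernel\<close>, named so that its joint measurability
  and its interplay with truncation can be stated.\<close>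

definition push_block :: "nat \<Rightarrow> (nat \<Rightarrow> 'y) \<Rightarrow> 'y \<Rightarrow> nat \<Rightarrow> 'y" where
  "push_block r x y = (\<lambda>i\<in>{..<r}. case i of 0 \<Rightarrow> y | Suc j \<Rightarrow> x j)"

lemma block_kernel_eq: "block_kernel k \<kappa> r x = distr (\<kappa> (restrict x {..<k})) (blocks r) (push_block r x)"
  by (simp add: block_kernel_def push_block_def[abs_def])

lemma measurable_push_block [measurable]:
  "(\<lambda>(x, y). push_block r x y) \<in> blocks r \<Otimes>\<^sub>M borel \<rightarrow>\<^sub>M blocks r"
  unfolding push_block_def split_beta
proof (rule measurable_restrict)
  fix i assume "i \<in> {..<r}"
  then show "(\<lambda>p. case i of 0 \<Rightarrow> snd p | Suc j \<Rightarrow> fst p j) \<in> blocks r \<Otimes>\<^sub>M borel \<rightarrow>\<^sub>M borel"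
    by (cases i) (auto intro!: measurable_compose[OF measurable_fst measurable_component_singleton])
qed

lemma measurable_push_block2:
  assumes "x \<in> space (blocks r)"
  shows "push_block r x \<in> borel \<rightarrow>\<^sub>M blocks r"
  using measurable_Pair2[OF measurable_push_block assms] by simp

lemma measurable_restrict_block:
  "k \<le> r \<Longrightarrow> (\<lambda>x. restrict x {..<k}) \<in> blocks r \<rightarrow>\<^sub>M blocks k"
  by (rule measurable_restrict_subset) auto

lemma markov_kernel_block_kernel:
  fixes \<kappa> :: "(nat \<Rightarrow> 'y) \<Rightarrow> 'y::topological_space measure"
  assumes "\<kappa> \<in> blocks k \<rightarrow>\<^sub>M prob_algebra borel" and "k \<le> r"
  shows "markov_kernel (blocks r) (block_kernel k \<kappa> r)"
proof
  have "(\<lambda>x. distr (\<kappa> (restrict x {..<k})) (blocks r) (push_block r x)) \<in> blocks r \<rightarrow>\<^sub>M prob_algebra (blocks r)"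
    by (intro measurable_distr_prob_space2[OF _ measurable_push_block]
        measurable_compose[OF measurable_restrict_block assms(1)] assms(2))
  then show "block_kernel k \<kappa> r \<in> blocks r \<rightarrow>\<^sub>M prob_algebra (blocks r)"
    by (simp add: block_kernel_eq[abs_def])
qed

context
  fixes k r :: nat and \<kappa> :: "(nat \<Rightarrow> 'y) \<Rightarrow> 'y::topological_space measure"
  assumes \<kappa>: "\<kappa> \<in> blocks k \<rightarrow>\<^sub>M prob_algebra borel" and k: "1 \<le> k" and kr: "k \<le> r"
begin

interpretation long: markov_kernel "blocks r" "block_kernel k \<kappa> r"
  by (rule markov_kernel_block_kernel[OF \<kappa> kr])

interpretation short: markov_kernel "blocks k" "block_kernel k \<kappa> k"
  by (rule markov_kernel_block_kernel[OF \<kappa> order.refl])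

lemma kappa_space:
  assumes "x \<in> space (blocks r)"
  shows "sets (\<kappa> (restrict x {..<k})) = sets borel" "space (\<kappa> (restrict x {..<k})) = UNIV"
    "prob_space (\<kappa> (restrict x {..<k}))"
proof -
  have "restrict x {..<k} \<in> space (blocks k)"
    using assms kr by (auto simp: space_PiM)
  from measurable_space[OF \<kappa> this]
  show "sets (\<kappa> (restrict x {..<k})) = sets borel" "space (\<kappa> (restrict x {..<k})) = UNIV"
    "prob_space (\<kappa> (restrict x {..<k}))"
    by (auto simp: space_prob_algebra dest: sets_eq_imp_space_eq)
qed

text \<open>After \<open>j\<close> steps only the first \<open>r - j\<close> old coordinates
  survive, and \<open>\<kappa>\<close> reads only the first \<open>k\<close>. For
  \<open>j = r - k\<close> the law therefore depends on the first \<open>k\<close> coordinates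
  alone.\<close>

lemma kernel_power_forgets:
  assumes "x \<in> space (blocks r)" "x' \<in> space (blocks r)"
    and "\<And>i. i < r - j \<or> i < k \<Longrightarrow> x i = x' i"
  shows "kernel_power (blocks r) (block_kernel k \<kappa> r) j x = kernel_power (blocks r) (block_kernel k \<kappa> r) j x'"
  using assms
proof (induction j arbitrary: x x')
  case 0
  have "x = x'"
  proof
    fix i show "x i = x' i"
      using 0 by (cases "i < r") (auto simp: space_PiM PiE_iff extensional_def)
  qed
  then show ?case by simp
next
  case (Suc j)
  let ?K = "block_kernel k \<kappa> r"
  let ?P = "kernel_power (blocks r) ?K"
  \<comment> \<open>The first step is split off, so that the induction hypothesis applies to the
    block after one push.\<close>
  have unfold: "?P (Suc j) z = \<kappa> (restrict z {..<k}) \<bind> (\<lambda>y. ?P j (push_block r z y))"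
    if z: "z \<in> space (blocks r)" for z
  proof -
    have "?P (Suc j) z = ?P 1 z \<bind> ?P j"
      using long.kernel_power_add[OF z, of 1 j] by simp
    also have "?P 1 z = ?K z"
      using bind_return[OF long.kernel_subprob z] by simp
    also have "?K z \<bind> ?P j = \<kappa> (restrict z {..<k}) \<bind> (\<lambda>y. ?P j (push_block r z y))"
      unfolding block_kernel_eq
      by (rule bind_distr[OF _ long.kernel_power_subprob[unfolded block_kernel_eq[abs_def]]])
        (use measurable_push_block2[OF z] kappa_space[OF z] in
          \<open>auto cong: measurable_cong_sets simp: prob_space.not_empty\<close>)
    finally show ?thesis .
  qed
  have r: "restrict x {..<k} = restrict x' {..<k}"
    using Suc.prems(3) by (auto simp: restrict_def)
  have "?P j (push_block r x y) = ?P j (push_block r x' y)" for y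
  proof (rule Suc.IH)
    show "push_block r x y \<in> space (blocks r)" "push_block r x' y \<in> space (blocks r)"
      using Suc.prems(1,2)[THEN measurable_push_block2, THEN measurable_space, of y] by auto
    fix i assume i: "i < r - j \<or> i < k"
    show "push_block r x y i = push_block r x' y i"
    proof (cases i)
      case (Suc l)
      \<comment> \<open>Coordinate \<open>l\<close> moves to \<open>Suc l\<close>, so agreement on
        one coordinate fewer at the start suffices.\<close>
      then have "l < r - Suc j \<or> l < k" using i by linarith
      with Suc Suc.prems(3) show ?thesis by (simp add: push_block_def)
    qed (simp add: push_block_def)
  qed
  then show ?case
    unfolding unfold[OF Suc.prems(1)] unfold[OF Suc.prems(2)] r by (intro bind_cong refl)
qed

text \<open>Truncation to the \<open>k\<close> most recent values commutes with pushing a new value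
  in front. Thus the short blocks of the long chain follow the short block kernel.\<close>

lemma distr_restrict_block_kernel:
  assumes x: "x \<in> space (blocks r)"
  shows "distr (block_kernel k \<kappa> r x) (blocks k) (\<lambda>x. restrict x {..<k}) = block_kernel k \<kappa> k (restrict x {..<k})"
proof -
  have "distr (block_kernel k \<kappa> r x) (blocks k) (\<lambda>x. restrict x {..<k})
      = distr (\<kappa> (restrict x {..<k})) (blocks k) ((\<lambda>x. restrict x {..<k}) \<circ> push_block r x)"
    unfolding block_kernel_eq
    by (rule distr_distr[OF measurable_restrict_block[OF kr]])
      (use measurable_push_block2[OF x] kappa_space[OF x] in \<open>auto cong: measurable_cong_sets\<close>)
  also have "(\<lambda>x. restrict x {..<k}) \<circ> push_block r x = push_block k (restrict x {..<k})"
    using kr by (auto simp: push_block_def restrict_def fun_eq_iff split: nat.split)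
  finally show ?thesis by (simp only: block_kernel_eq restrict_restrict Int_absorb)
qed

lemma distr_restrict_kernel_power:
  assumes x: "x \<in> space (blocks r)"
  shows "distr (kernel_power (blocks r) (block_kernel k \<kappa> r) s x) (blocks k) (\<lambda>x. restrict x {..<k})
    = kernel_power (blocks k) (block_kernel k \<kappa> k) s (restrict x {..<k})"
proof (induction s)
  case 0
  show ?case
    using distr_return[OF measurable_restrict_block[OF kr] x] by (simp only: kernel_power.simps)
next
  case (Suc s)
  let ?R = "\<lambda>x. restrict x {..<k}"
  let ?P = "kernel_power (blocks r) (block_kernel k \<kappa> r) s x"
  note sets_P = long.sets_kernel_power[OF x, of s]
  interpret P: prob_space ?P by (rule long.prob_space_kernel_power[OF x])
  have "distr (?P \<bind> block_kernel k \<kappa> r) (blocks k) ?R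
      = ?P \<bind> (\<lambda>y. distr (block_kernel k \<kappa> r y) (blocks k) ?R)"
    by (rule distr_bind[OF _ _ measurable_restrict_block[OF kr]])
      (use long.kernel_subprob sets_P P.not_empty in \<open>auto cong: measurable_cong_sets\<close>)
  also have "\<dots> = ?P \<bind> (\<lambda>y. block_kernel k \<kappa> k (?R y))"
    by (rule bind_cong[OF refl]) (simp add: distr_restrict_block_kernel long.space_kernel_power[OF x])
  also have "\<dots> = distr ?P (blocks k) ?R \<bind> block_kernel k \<kappa> k"
    by (rule bind_distr[symmetric, OF _ short.kernel_subprob])
      (use measurable_restrict_block[OF kr] sets_P P.not_empty in \<open>auto cong: measurable_cong_sets\<close>)
  finally show ?case using Suc by (simp only: kernel_power.simps)
qed

text \<open>By \<open>kernel_power_forgets\<close>, the probability of \<open>A\<close> after the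
  final \<open>r - k\<close> steps is a function \<open>H\<close> of the truncated block. Invariance
  lets \<open>Q\<close> be written with the same \<open>H\<close>, so the two probabilities are
  integrals of one function in the unit interval against two short-block laws.\<close>

lemma d_TV_long_blocks_le:
  assumes Q: "stationary_markov_kernel (blocks r) (block_kernel k \<kappa> r) Q"
    and x: "x \<in> space (blocks r)"
  shows "d_TV (kernel_power (blocks r) (block_kernel k \<kappa> r) (s + (r - k)) x) Q
    \<le> d_TV (kernel_power (blocks k) (block_kernel k \<kappa> k) s (restrict x {..<k})) (distr Q (blocks k) (\<lambda>x. restrict x {..<k}))"
proof (rule d_TV_le)
  interpret Q: stationary_markov_kernel "blocks r" "block_kernel k \<kappa> r" Q by (rule Q)
  let ?P = "kernel_power (blocks r) (block_kernel k \<kappa> r)"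
  let ?R = "\<lambda>x. restrict x {..<k}"
  fix A assume "A \<in> sets (?P (s + (r - k)) x)"
  then have A: "A \<in> sets (blocks r)" by (simp add: long.sets_kernel_power[OF x])
  \<comment> \<open>The filler \<open>undefined\<close> on the coordinates from \<open>k\<close> on
    is harmless: these coordinates are pushed out within \<open>r - k\<close> steps.\<close>
  define ext where "ext z = (\<lambda>i\<in>{..<r}. if i < k then z i else undefined)" for z :: "nat \<Rightarrow> 'y"
  have ext: "ext \<in> blocks k \<rightarrow>\<^sub>M blocks r"
    unfolding ext_def[abs_def]
  proof (rule measurable_restrict)
    fix i assume "i \<in> {..<r}"
    show "(\<lambda>z. if i < k then z i else undefined) \<in> blocks k \<rightarrow>\<^sub>M borel"
      by (cases "i < k") auto
  qed
  define H where "H z = measure (?P (r - k) (ext z)) A" for z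
  have H: "H \<in> borel_measurable (blocks k)"
    unfolding H_def[abs_def]
    by (intro measurable_compose[OF ext] measurable_compose[OF long.kernel_power_subprob]
        measurable_measure_subprob_algebra A)
  have H01: "0 \<le> H z \<and> H z \<le> 1" if "z \<in> space (blocks k)" for z
    unfolding H_def using prob_space.prob_le_1[OF long.prob_space_kernel_power] measurable_space[OF ext that]
    by auto
  have HR: "measure (?P (r - k) y) A = H (?R y)" if y: "y \<in> space (blocks r)" for y
  proof -
    have "?R y \<in> space (blocks k)" using measurable_space[OF measurable_restrict_block[OF kr] y] .
    then have "ext (?R y) \<in> space (blocks r)" by (rule measurable_space[OF ext])
    then have "?P (r - k) y = ?P (r - k) (ext (?R y))"
      by (intro kernel_power_forgets y) (use kr in \<open>auto simp: ext_def\<close>)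
    then show ?thesis by (simp add: H_def)
  qed
  have meas_bind: "measure (P \<bind> ?P (r - k)) A = (\<integral>z. H z \<partial>distr P (blocks k) ?R)"
    if P: "P \<in> space (prob_algebra (blocks r))" for P
  proof -
    have sP: "sets P = sets (blocks r)" "space P = space (blocks r)"
      using P by (auto simp: space_prob_algebra dest: sets_eq_imp_space_eq)
    have R: "?R \<in> P \<rightarrow>\<^sub>M blocks k"
      using measurable_restrict_block[OF kr] sP by (simp cong: measurable_cong_sets)
    have "sets (P \<bind> ?P (r - k)) = sets (blocks r)"
      by (rule sets_bind'[OF P long.kernel_power_measurable])
    from this sets_eq_imp_space_eq[OF this]
    have "measure (P \<bind> ?P (r - k)) A = (\<integral>y. indicator A y \<partial>(P \<bind> ?P (r - k)))"
      using A sets.sets_into_space[OF A] by (simp add: Int_absorb2)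
    also have "\<dots> = (\<integral>y. (\<integral>z. indicator A z \<partial>?P (r - k) y) \<partial>P)"
      by (rule integral_bind_bounded[OF P long.kernel_power_measurable, where B = 1])
        (use A in \<open>auto simp: indicator_def\<close>)
    also have "\<dots> = (\<integral>y. H (?R y) \<partial>P)"
    proof (rule Bochner_Integration.integral_cong[OF refl])
      fix y assume "y \<in> space P"
      then have y: "y \<in> space (blocks r)" by (simp add: sP)
      show "(\<integral>z. indicator A z \<partial>?P (r - k) y) = H (?R y)"
        using HR[OF y] long.space_kernel_power[OF y] sets.sets_into_space[OF A] by (simp add: Int_absorb2)
    qed
    also have "\<dots> = (\<integral>z. H z \<partial>distr P (blocks k) ?R)"
      by (rule integral_distr[OF R H, symmetric])
    finally show ?thesis .
  qed
  have 1: "measure (?P (s + (r - k)) x) A = (\<integral>z. H z \<partial>kernel_power (blocks k) (block_kernel k \<kappa> k) s (?R x))"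
    using meas_bind[OF long.kernel_power_space[OF x]] long.kernel_power_add[OF x, of s "r - k"]
    by (simp add: distr_restrict_kernel_power[OF x])
  have 2: "measure Q A = (\<integral>z. H z \<partial>distr Q (blocks k) ?R)"
    using meas_bind[OF Q.Q_space] Q.invariant_kernel_power by simp
  have Rx: "?R x \<in> space (blocks k)" using measurable_space[OF measurable_restrict_block[OF kr] x] .
  have R: "?R \<in> Q \<rightarrow>\<^sub>M blocks k"
    using measurable_restrict_block[OF kr] Q.sets_Q by (simp cong: measurable_cong_sets)
  show "\<bar>measure (?P (s + (r - k)) x) A - measure Q A\<bar>
      \<le> d_TV (kernel_power (blocks k) (block_kernel k \<kappa> k) s (?R x)) (distr Q (blocks k) ?R)"
    unfolding 1 2
    by (rule d_TV_integral_unit)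
      (use short.prob_space_kernel_power[OF Rx] Q.Q.prob_space_distr[OF R] short.sets_kernel_power[OF Rx]
        short.space_kernel_power[OF Rx] H H01 in \<open>auto cong: measurable_cong_sets\<close>)
qed

end

subsection \<open>Stationarity and mixing of blocks\<close>

lemma measurable_block:
  assumes "\<And>s. Y s \<in> M \<rightarrow>\<^sub>M borel"
  shows "block Y r t \<in> M \<rightarrow>\<^sub>M blocks r"
  unfolding block_def[abs_def] by (intro measurable_restrict assms)

text \<open>A block at time \<open>t\<close> is a fixed projection \<open>g\<close> of the path
  shifted by \<open>t\<close>, and stationarity equates the laws of all shifted paths.\<close>

lemma distr_block_stationary:
  fixes Y :: "int \<Rightarrow> 'w \<Rightarrow> 'y::topological_space"
  assumes Y: "\<And>s. Y s \<in> M \<rightarrow>\<^sub>M borel" and st: "stationary M Y"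
  shows "distr M (blocks r) (block Y r t) = block_law M Y r"
proof -
  define g where "g z = (\<lambda>i\<in>{..<r}. z (- int i))" for z :: "int \<Rightarrow> 'y"
  have g: "g \<in> PiM UNIV (\<lambda>_. borel) \<rightarrow>\<^sub>M blocks r"
    unfolding g_def[abs_def] by (intro measurable_restrict measurable_component_singleton) auto
  have Y': "(\<lambda>\<omega> s. Y (s + h) \<omega>) \<in> M \<rightarrow>\<^sub>M PiM UNIV (\<lambda>_. borel)" for h
    by (intro measurable_PiM_single') (auto intro: Y)
  have eq: "distr (distr M (PiM UNIV (\<lambda>_. borel)) (\<lambda>\<omega> s. Y (s + h) \<omega>)) (blocks r) g = distr M (blocks r) (block Y r h)" for h
  proof -
    have "g \<circ> (\<lambda>\<omega> s. Y (s + h) \<omega>) = block Y r h"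
      by (simp add: fun_eq_iff g_def block_def)
    then show ?thesis by (simp only: distr_distr[OF g Y'])
  qed
  have shift: "distr M (PiM UNIV (\<lambda>_. borel)) (\<lambda>\<omega> s. Y (s + h) \<omega>) = distr M (PiM UNIV (\<lambda>_. borel)) (\<lambda>\<omega> s. Y s \<omega>)" for h
    using st unfolding stationary_def by (rule spec)
  show ?thesis
    using eq[of t] eq[of 0] unfolding shift[of t] shift[of 0] block_law_def by (rule trans[OF sym])
qed

section \<open>From the process to its chain of blocks\<close>

context
  fixes M :: "'w measure" and Y :: "int \<Rightarrow> 'w \<Rightarrow> 'y::topological_space"
    and \<kappa> :: "(nat \<Rightarrow> 'y) \<Rightarrow> 'y measure" and k :: nat
  assumes chain: "homogeneous_markov_chain M k \<kappa> Y" and st: "stationary M Y"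
begin

interpretation M: prob_space M
  using chain by (simp add: homogeneous_markov_chain_def)

lemma Y_measurable: "Y s \<in> M \<rightarrow>\<^sub>M borel"
  using chain by (simp add: homogeneous_markov_chain_def)

lemma kappa_measurable: "\<kappa> \<in> blocks k \<rightarrow>\<^sub>M prob_algebra borel"
  using chain by (simp add: homogeneous_markov_chain_def)

lemma past_measurable:
  assumes "s < t"
  shows "Y s \<in> past M Y t \<rightarrow>\<^sub>M borel"
proof -
  have 1: "(\<lambda>\<omega>. \<lambda>s\<in>{..<t}. Y s \<omega>) \<in> past M Y t \<rightarrow>\<^sub>M PiM {..<t} (\<lambda>_. borel)"
    unfolding past_def by (rule measurable_vimage_algebra1) (auto simp: space_PiM)
  have "(\<lambda>\<omega>. (\<lambda>s\<in>{..<t}. Y s \<omega>) s) \<in> past M Y t \<rightarrow>\<^sub>M borel"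
    using assms by (intro measurable_compose[OF 1] measurable_component_singleton) auto
  then show ?thesis using assms by simp
qed

lemma subalgebra_past: "subalgebra M (past M Y t)"
proof -
  have "(\<lambda>\<omega>. \<lambda>s\<in>{..<t}. Y s \<omega>) \<in> M \<rightarrow>\<^sub>M PiM {..<t} (\<lambda>_. borel)"
    by (intro measurable_restrict Y_measurable)
  from sets_image_in_sets[OF refl this] show ?thesis
    by (simp add: subalgebra_def past_def)
qed

text \<open>The conditional probability in the Markov property, integrated over an event
  \<open>E\<close> of the past; in this form it can be matched with the emeasure of a bind.\<close>

lemma one_step_law:
  assumes E: "E \<in> sets (past M Y t)" and A: "A \<in> sets borel"
  shows "emeasure M (E \<inter> (Y t -` A \<inter> space M))
    = (\<integral>\<^sup>+\<omega>. indicator E \<omega> * emeasure (\<kappa> (block Y k (t - 1) \<omega>)) A \<partial>M)"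
proof -
  interpret sub: finite_measure_subalgebra M "past M Y t"
    by unfold_locales (rule subalgebra_past)
  have EM: "E \<in> sets M"
    using E subalgebra_past by (auto simp: subalgebra_def)
  let ?B = "Y t -` A \<inter> space M"
  let ?p = "\<lambda>\<omega>. measure (\<kappa> (block Y k (t - 1) \<omega>)) A"
  have B: "?B \<in> sets M"
    by (rule measurable_sets[OF Y_measurable A])
  have \<kappa>_at: "\<kappa> (block Y k (t - 1) \<omega>) \<in> space (prob_algebra borel)" if "\<omega> \<in> space M" for \<omega>
    by (rule measurable_space[OF kappa_measurable measurable_space[OF measurable_block[OF Y_measurable] that]])
  have p_meas: "?p \<in> borel_measurable M"
    by (rule measurable_compose[OF measurable_compose[OF measurable_block[OF Y_measurable] kappa_measurable]
          measurable_measure_prob_algebra[OF A]])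
  have p01: "0 \<le> ?p \<omega> \<and> ?p \<omega> \<le> 1" if "\<omega> \<in> space M" for \<omega>
    using \<kappa>_at[OF that] by (auto simp: space_prob_algebra intro: prob_space.prob_le_1)
  have i: "integrable M (\<lambda>\<omega>. indicator E \<omega> * ?p \<omega>)"
    by (rule M.integrable_const_bound[where B = 1])
      (use p01 p_meas EM in \<open>auto simp: indicator_def intro!: AE_I2\<close>)
  have "measure M (E \<inter> ?B) = (\<integral>\<omega>\<in>E. indicator ?B \<omega> \<partial>M)"
    using EM B sets.sets_into_space[OF EM]
    by (simp add: set_lebesgue_integral_def indicator_inter_arith[symmetric] Int_absorb2 Int_absorb1 le_infI1)
  also have "\<dots> = (\<integral>\<omega>\<in>E. real_cond_exp M (past M Y t) (indicator ?B) \<omega> \<partial>M)"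
    using B by (intro sub.real_cond_exp_intA E) (simp add: M.emeasure_eq_measure)
  also have "\<dots> = (\<integral>\<omega>\<in>E. ?p \<omega> \<partial>M)"
    unfolding set_lebesgue_integral_def
  proof (rule integral_cong_AE)
    have "AE \<omega> in M. real_cond_exp M (past M Y t) (indicator ?B) \<omega> = ?p \<omega>"
      using chain A by (simp add: homogeneous_markov_chain_def)
    then show "AE \<omega> in M. indicator E \<omega> *\<^sub>R real_cond_exp M (past M Y t) (indicator ?B) \<omega> = indicator E \<omega> *\<^sub>R ?p \<omega>"
      by eventually_elim simp
  qed (use EM p_meas in measurable)
  finally have "ennreal (measure M (E \<inter> ?B)) = ennreal (\<integral>\<omega>. indicator E \<omega> * ?p \<omega> \<partial>M)"
    by (simp add: set_lebesgue_integral_def)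
  also have "\<dots> = (\<integral>\<^sup>+\<omega>. ennreal (indicator E \<omega> * ?p \<omega>) \<partial>M)"
    by (rule nn_integral_eq_integral[OF i, symmetric]) (auto intro!: AE_I2)
  also have "\<dots> = (\<integral>\<^sup>+\<omega>. indicator E \<omega> * emeasure (\<kappa> (block Y k (t - 1) \<omega>)) A \<partial>M)"
  proof (rule nn_integral_cong)
    fix \<omega> assume "\<omega> \<in> space M"
    then interpret \<kappa>: prob_space "\<kappa> (block Y k (t - 1) \<omega>)"
      using \<kappa>_at by (simp add: space_prob_algebra)
    show "ennreal (indicator E \<omega> * ?p \<omega>) = indicator E \<omega> * emeasure (\<kappa> (block Y k (t - 1) \<omega>)) A"
      by (simp add: \<kappa>.emeasure_eq_measure indicator_def)
  qed
  finally show ?thesis by (simp add: M.emeasure_eq_measure)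
qed

lemma block_law_space: "block_law M Y r \<in> space (prob_algebra (blocks r))"
  unfolding block_law_def space_prob_algebra
  by (auto intro!: M.prob_space_distr measurable_block Y_measurable)

text \<open>Both sides are probability measures on a finite product, so rectangles suffice. On a
  rectangle the newest coordinate is handled by \<open>one_step_law\<close>, and the others form an
  event of the past.\<close>

lemma block_law_invariant:
  assumes k: "1 \<le> k" and kr: "k \<le> r"
  shows "block_law M Y r \<bind> block_kernel k \<kappa> r = block_law M Y r"
proof -
  let ?Q = "block_law M Y r" and ?K = "block_kernel k \<kappa> r"
  have r: "1 \<le> r" using k kr by simp
  interpret K: markov_kernel "blocks r" ?K
    by (rule markov_kernel_block_kernel[OF kappa_measurable kr])
  have setsQ: "sets ?Q = sets (blocks r)" by (simp add: block_law_def)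
  have setsB: "sets (?Q \<bind> ?K) = sets (blocks r)"
    by (rule sets_bind'[OF block_law_space K.kernel])
  interpret B: prob_space "?Q \<bind> ?K"
    by (rule prob_space_bind'[OF block_law_space K.kernel])
  show ?thesis
  proof (rule measure_eqI_PiM_finite[where I = "{..<r}" and M = "\<lambda>_. borel" and A = "\<lambda>_. space (blocks r)"])
    fix A :: "nat \<Rightarrow> 'y set" assume A: "\<And>i. i \<in> {..<r} \<Longrightarrow> A i \<in> sets borel"
    let ?X = "PiE {..<r} A"
    have X: "?X \<in> sets (blocks r)" using A by (intro sets_PiM_I_finite) auto
    \<comment> \<open>Coordinates \<open>1\<close> to \<open>r - 1\<close> of the block at time 0,
      that is, the values at times \<open>-1\<close> down to \<open>-(r - 1)\<close>.\<close>
    define E where "E = {\<omega> \<in> space M. \<forall>j\<in>{..<r - 1}. Y (- 1 - int j) \<omega> \<in> A (Suc j)}"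
    have E: "E \<in> sets (past M Y 0)"
    proof -
      have sp: "space (past M Y 0) = space M" by (simp add: past_def)
      have "{\<omega> \<in> space (past M Y 0). \<forall>j\<in>{..<r - 1}. Y (- 1 - int j) \<omega> \<in> A (Suc j)} \<in> sets (past M Y 0)"
      proof (rule sets.sets_Collect_finite_All)
        fix j assume j: "j \<in> {..<r - 1}"
        have "Y (- 1 - int j) -` A (Suc j) \<inter> space (past M Y 0) \<in> sets (past M Y 0)"
          using j by (intro measurable_sets[OF past_measurable] A) auto
        then show "{\<omega> \<in> space (past M Y 0). Y (- 1 - int j) \<omega> \<in> A (Suc j)} \<in> sets (past M Y 0)"
          by (simp add: vimage_def Int_def conj_commute)
      qed auto
      then show ?thesis by (simp add: E_def sp)
    qed
    have "emeasure (?Q \<bind> ?K) ?X = (\<integral>\<^sup>+w. emeasure (?K w) ?X \<partial>?Q)"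
      by (rule emeasure_bind_prob_algebra[OF block_law_space K.kernel X])
    \<comment> \<open>Stationarity places the starting block at time \<open>-1\<close>, so that the
      pushed value is the one at time 0.\<close>
    also have "\<dots> = (\<integral>\<^sup>+w. emeasure (?K w) ?X \<partial>distr M (blocks r) (block Y r (- 1)))"
      by (simp add: distr_block_stationary[OF Y_measurable st])
    also have "\<dots> = (\<integral>\<^sup>+\<omega>. emeasure (?K (block Y r (- 1) \<omega>)) ?X \<partial>M)"
      using measurable_compose[OF K.kernel_subprob measurable_emeasure_subprob_algebra[OF X]]
      by (intro nn_integral_distr measurable_block Y_measurable) simp
    also have "\<dots> = (\<integral>\<^sup>+\<omega>. indicator E \<omega> * emeasure (\<kappa> (block Y k (0 - 1) \<omega>)) (A 0) \<partial>M)"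
    proof (rule nn_integral_cong)
      fix \<omega> assume \<omega>: "\<omega> \<in> space M"
      let ?w = "block Y r (- 1) \<omega>"
      have w: "?w \<in> space (blocks r)"
        by (rule measurable_space[OF measurable_block[OF Y_measurable] \<omega>])
      have rw: "restrict ?w {..<k} = block Y k (0 - 1) \<omega>"
        using kr by (auto simp: block_def restrict_def fun_eq_iff)
      have "emeasure (?K ?w) ?X = emeasure (\<kappa> (restrict ?w {..<k})) (push_block r ?w -` ?X \<inter> space (\<kappa> (restrict ?w {..<k})))"
        unfolding block_kernel_eq using X measurable_push_block2[OF w] kappa_space[OF kappa_measurable k kr w]
        by (intro emeasure_distr) (auto cong: measurable_cong_sets)
      also have "push_block r ?w -` ?X \<inter> space (\<kappa> (restrict ?w {..<k})) = (if \<omega> \<in> E then A 0 else {})"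
      proof -
        have "push_block r ?w y \<in> ?X \<longleftrightarrow> \<omega> \<in> E \<and> y \<in> A 0" for y
        proof -
          have "push_block r ?w y \<in> ?X \<longleftrightarrow> (\<forall>i<r. push_block r ?w y i \<in> A i)"
            by (auto simp: PiE_iff push_block_def)
          also have "\<dots> \<longleftrightarrow> y \<in> A 0 \<and> (\<forall>j<r - 1. push_block r ?w y (Suc j) \<in> A (Suc j))"
          proof -
            obtain r' where r': "r = Suc r'" using r by (cases r) auto
            show ?thesis unfolding r' by (simp add: All_less_Suc2) (simp add: push_block_def)
          qed
          also have "\<dots> \<longleftrightarrow> \<omega> \<in> E \<and> y \<in> A 0"
            using \<omega> by (auto simp: E_def push_block_def block_def)
          finally show ?thesis .
        qed
        then show ?thesis using kappa_space(2)[OF kappa_measurable k kr w] by auto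
      qed
      finally show "emeasure (?K ?w) ?X = indicator E \<omega> * emeasure (\<kappa> (block Y k (0 - 1) \<omega>)) (A 0)"
        by (simp add: rw)
    qed
    also have "\<dots> = emeasure M (E \<inter> (Y 0 -` A 0 \<inter> space M))"
      using A r by (intro one_step_law[symmetric] E) auto
    also have "E \<inter> (Y 0 -` A 0 \<inter> space M) = block Y r 0 -` ?X \<inter> space M"
    proof -
      obtain r' where r': "r = Suc r'" using r by (cases r) auto
      have "block Y r 0 \<omega> \<in> ?X \<longleftrightarrow> (\<forall>i<r. Y (- int i) \<omega> \<in> A i)" for \<omega>
        by (auto simp: PiE_iff block_def)
      then show ?thesis
        unfolding r' by (auto simp: All_less_Suc2 E_def r')
    qed
    also have "emeasure M (block Y r 0 -` ?X \<inter> space M) = emeasure ?Q ?X"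
      unfolding block_law_def by (rule emeasure_distr[symmetric]) (intro measurable_block Y_measurable X)+
    finally show "emeasure (?Q \<bind> ?K) ?X = emeasure ?Q ?X" .
  next
    show "range (\<lambda>_. space (blocks r)) \<subseteq> prod_algebra {..<r} (\<lambda>_. borel :: 'y measure)"
      by (auto simp: space_PiM intro!: prod_algebraI_finite)
  qed (auto simp: setsB setsQ)
qed

lemma stationary_markov_kernel_blocks:
  assumes k: "1 \<le> k" and kr: "k \<le> r"
  shows "stationary_markov_kernel (blocks r) (block_kernel k \<kappa> r) (block_law M Y r)"
proof -
  interpret K: markov_kernel "blocks r" "block_kernel k \<kappa> r"
    by (rule markov_kernel_block_kernel[OF kappa_measurable kr])
  show ?thesis
    by unfold_locales (rule block_law_space, rule block_law_invariant[OF k kr])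
qed

lemma distr_restrict_block_law:
  assumes "k \<le> r"
  shows "distr (block_law M Y r) (blocks k) (\<lambda>x. restrict x {..<k}) = block_law M Y k"
proof -
  have "(\<lambda>x. restrict x {..<k}) \<circ> block Y r 0 = block Y k 0"
    using assms by (auto simp: block_def restrict_def fun_eq_iff)
  then show ?thesis
    unfolding block_law_def
    by (simp only: distr_distr[OF measurable_restrict_block[OF assms] measurable_block[OF Y_measurable]])
qed

text \<open>Ergodicity is given for blocks of length \<open>k\<close> and passes to length
  \<open>r\<close> at the cost of \<open>r - k\<close> further steps. It yields a time satisfying
  the condition in \<open>mixing_time\<close>, which the \<open>LEAST\<close> operator needs to be
  meaningful.\<close>

lemma mixing_markov_kernel_blocks:
  assumes k: "1 \<le> k" and kr: "k \<le> r" and erg: "uniformly_ergodic_chain M k \<kappa> Y"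
  shows "mixing_markov_kernel (blocks r) (block_kernel k \<kappa> r) (block_law M Y r)
    (mixing_time (blocks r) (block_kernel k \<kappa> r) (block_law M Y r))"
proof -
  let ?K = "block_kernel k \<kappa> r" and ?Q = "block_law M Y r"
  interpret long: stationary_markov_kernel "blocks r" ?K ?Q
    by (rule stationary_markov_kernel_blocks[OF k kr])
  interpret short: stationary_markov_kernel "blocks k" "block_kernel k \<kappa> k" "block_law M Y k"
    by (rule stationary_markov_kernel_blocks[OF k order.refl])
  let ?P = "kernel_power (blocks r) ?K"
  let ?p = "kernel_power (blocks k) (block_kernel k \<kappa> k)"
  have ne: "space (blocks r :: (nat \<Rightarrow> 'y) measure) \<noteq> {}" by (simp add: space_PiM PiE_eq_empty_iff)
  have bdd: "bdd_above ((\<lambda>x. d_TV (?P n x) ?Q) ` space (blocks r))" for n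
    by (intro bdd_aboveI2[where M = 1] d_TV_le_1 long.prob_space_kernel_power long.Q.prob_space_axioms)
  have bdd': "bdd_above ((\<lambda>x. d_TV (?p n x) (block_law M Y k)) ` space (blocks k))" for n
    by (intro bdd_aboveI2[where M = 1] d_TV_le_1 short.prob_space_kernel_power short.Q.prob_space_axioms)
  obtain C \<rho> where C: "C > 0" and \<rho>: "0 < \<rho>" "\<rho> < 1"
    and sup: "\<And>n. (SUP x\<in>space (blocks k). d_TV (?p n x) (block_law M Y k)) \<le> C * \<rho> ^ n"
    using erg unfolding uniformly_ergodic_chain_def uniformly_ergodic_def by blast
  obtain s where "\<rho> ^ s < 1 / (4 * C)"
    using real_arch_pow_inv[OF _ \<rho>(2), of "1 / (4 * C)"] C by auto
  then have "C * \<rho> ^ s \<le> 1 / 4" using C by (simp add: field_simps)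
  moreover have "\<rho> ^ Suc s \<le> \<rho> ^ s" using \<rho> by (intro power_decreasing) auto
  \<comment> \<open>\<open>Suc s\<close> instead of \<open>s\<close> makes the time at least 1, even
    when \<open>r = k\<close>.\<close>
  ultimately have s: "C * \<rho> ^ Suc s \<le> 1 / 4" using C mult_left_mono[of "\<rho> ^ Suc s" "\<rho> ^ s" C] by linarith
  define good where "good t \<longleftrightarrow> 1 \<le> t \<and> (SUP x\<in>space (blocks r). d_TV (?P t x) ?Q) \<le> 1 / 4" for t
  have "good (Suc s + (r - k))"
    unfolding good_def
  proof (intro conjI cSUP_least[OF ne])
    fix x :: "nat \<Rightarrow> 'y" assume x: "x \<in> space (blocks r)"
    have Rx: "restrict x {..<k} \<in> space (blocks k)" by (rule measurable_space[OF measurable_restrict_block[OF kr] x])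
    have "d_TV (?P (Suc s + (r - k)) x) ?Q \<le> d_TV (?p (Suc s) (restrict x {..<k})) (block_law M Y k)"
      using d_TV_long_blocks_le[OF kappa_measurable k kr long.stationary_markov_kernel_axioms x, of "Suc s"]
      unfolding distr_restrict_block_law[OF kr] .
    also have "\<dots> \<le> (SUP x\<in>space (blocks k). d_TV (?p (Suc s) x) (block_law M Y k))"
      by (rule cSUP_upper[OF Rx bdd'])
    also have "\<dots> \<le> C * \<rho> ^ Suc s" by (rule sup)
    finally show "d_TV (?P (Suc s + (r - k)) x) ?Q \<le> 1 / 4" using s by linarith
  qed simp
  then have "good (LEAST t. good t)" by (rule LeastI)
  then have mt: "good (mixing_time (blocks r) ?K ?Q)"
    by (simp add: mixing_time_def good_def[abs_def])
  show ?thesis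
  proof
    show "1 \<le> mixing_time (blocks r) ?K ?Q" using mt by (simp add: good_def)
    show "d_TV (?P (mixing_time (blocks r) ?K ?Q) x) ?Q \<le> 1 / 4" if "x \<in> space (blocks r)" for x
      using cSUP_upper[OF that bdd] mt unfolding good_def by (rule order.trans[OF _ conjunct2])
  qed
qed

end

subsection \<open>Losses\<close>

lemma measurable_loss_at:
  assumes L: "loss_function L" and g: "g \<in> predictors p"
  shows "loss_at L p g \<in> borel_measurable (blocks (p + 1))"
proof -
  have "(\<lambda>x. \<lambda>i\<in>{..<p}. x (Suc i)) \<in> blocks (p + 1) \<rightarrow>\<^sub>M blocks p"
    by (intro measurable_restrict measurable_component_singleton) auto
  from measurable_compose[OF this] g
  have "(\<lambda>x. g (\<lambda>i\<in>{..<p}. x (Suc i))) \<in> blocks (p + 1) \<rightarrow>\<^sub>M borel"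
    by (simp add: predictors_def)
  moreover have "(\<lambda>x. x 0) \<in> blocks (p + 1) \<rightarrow>\<^sub>M borel"
    by (intro measurable_component_singleton) auto
  ultimately have "(\<lambda>x. (g (\<lambda>i\<in>{..<p}. x (Suc i)), x 0)) \<in> blocks (p + 1) \<rightarrow>\<^sub>M borel \<Otimes>\<^sub>M borel"
    by (rule measurable_Pair)
  moreover have "L \<in> borel_measurable (borel \<Otimes>\<^sub>M borel)"
    using L by (simp add: loss_function_def)
  ultimately have "(\<lambda>x. L (g (\<lambda>i\<in>{..<p}. x (Suc i)), x 0)) \<in> borel_measurable (blocks (p + 1))"
    by (rule measurable_compose)
  then show ?thesis
    by (simp add: loss_at_def[abs_def])
qed

lemma empirical_loss_reindex:
  "empirical_loss L p n m (\<lambda>j\<in>{n + 1..n + m}. \<omega> (j - n)) g = (\<Sum>j = 1..m. loss_at L p g (\<omega> j)) / real m"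
proof -
  have "(\<Sum>j = n + 1..n + m. loss_at L p g ((\<lambda>j\<in>{n + 1..n + m}. \<omega> (j - n)) j))
      = (\<Sum>j = 1..m. loss_at L p g (\<omega> j))"
    by (rule sum.reindex_bij_witness[where i = "\<lambda>j. j + n" and j = "\<lambda>j. j - n"]) auto
  then show ?thesis by (simp add: empirical_loss_def)
qed

text \<open>The factor after \<open>exp 1 * N\<close> in the logarithm is at least 1, which gives
  \<open>1 + ln N\<close>. Moreover \<open>(1 + 9 * ln 2) / ln 2\<close> is
  \<open>9 + 1 / ln 2\<close>, and \<open>6 = 2 * sqrt 9\<close>.\<close>

lemma rate_le_bound:
  fixes N m :: nat and t :: real
  assumes N: "1 \<le> N" and m: "1 \<le> m" and t: "1 \<le> t"
  defines "B \<equiv> ln (exp 1 * real N * (2 * exp (ln 2 / t) + 1))"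
  shows "1 + ln (real N) \<le> B"
    and "6 * sqrt (B * (t / real m)) \<le> 2 * sqrt (B * (1 + 9 * ln 2) * t / (real m * ln 2))"
proof -
  have "exp 1 * real N \<le> exp 1 * real N * (2 * exp (ln 2 / t) + 1)"
    using N mult_left_mono[of 1 "2 * exp (ln 2 / t) + 1" "exp 1 * real N"] by simp
  then have "ln (exp 1 * real N) \<le> B"
    unfolding B_def using N by (intro ln_mono) (auto intro!: mult_pos_pos add_pos_pos)
  then show B: "1 + ln (real N) \<le> B"
    using N by (simp add: ln_mult)
  moreover have "0 \<le> ln (real N)" using N by (intro ln_ge_zero) simp
  ultimately have B0: "0 \<le> B" by linarith
  have "9 * (B * (t / real m)) \<le> B * (t / real m) * ((1 + 9 * ln 2) / ln 2)"
  proof -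
    have "9 \<le> (1 + 9 * ln 2) / ln (2::real)" by (simp add: field_simps)
    from mult_left_mono[OF this, of "B * (t / real m)"] show ?thesis
      using B0 t by (simp add: mult.commute)
  qed
  also have "\<dots> = B * (1 + 9 * ln 2) * t / (real m * ln 2)"
    by simp
  finally have "sqrt (9 * (B * (t / real m))) \<le> sqrt (B * (1 + 9 * ln 2) * t / (real m * ln 2))"
    by (rule real_sqrt_le_mono)
  moreover have "sqrt (9 * (B * (t / real m))) = 3 * sqrt (B * (t / real m))"
    by (simp only: real_sqrt_mult) simp
  ultimately show "6 * sqrt (B * (t / real m)) \<le> 2 * sqrt (B * (1 + 9 * ln 2) * t / (real m * ln 2))"
    by linarith
qed

section \<open>Transfer to the validation sample\<close>

theorem theorem3p3:
  fixes M :: "'w measure"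
    and Y :: "int \<Rightarrow> 'w \<Rightarrow> 'y::polish_space"
    and \<kappa> :: "(nat \<Rightarrow> 'y) \<Rightarrow> 'y measure"
    and k\<^sub>0 p n m N ktilde :: nat
    and L Ltilde :: "'y \<times> 'y \<Rightarrow> real"
    and G :: "nat \<Rightarrow> ((nat \<Rightarrow> 'y) \<Rightarrow> 'y) set"
    and x :: "nat \<Rightarrow> nat \<Rightarrow> 'y"
    and ghat :: "nat \<Rightarrow> (nat \<Rightarrow> 'y) \<Rightarrow> 'y"
    and khat :: "(nat \<Rightarrow> nat \<Rightarrow> 'y) \<Rightarrow> nat"
  defines "S \<equiv> blocks (p + 1)"
    and "K \<equiv> block_kernel k\<^sub>0 \<kappa> (p + 1)"
    and "Q \<equiv> block_law M Y (p + 1)"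
  defines "V \<equiv> validation_law S K (x n) n m"
    and "tmix \<equiv> real (mixing_time S K Q)"
    and "EL \<equiv> expected_loss Q L p"
  defines "bound \<equiv> 2 * sqrt (ln (exp 1 * real N * (2 * exp (ln 2 / tmix) + 1))
                              * (1 + 9 * ln 2) * tmix / (real m * ln 2))"
  assumes "1 \<le> k\<^sub>0" and "k\<^sub>0 \<le> p" and "1 \<le> n" and "1 \<le> m" and "1 \<le> N"
    and "homogeneous_markov_chain M k\<^sub>0 \<kappa> Y" and "stationary M Y"
    and "uniformly_ergodic_chain M k\<^sub>0 \<kappa> Y"
    and "loss_function L" and "loss_function Ltilde"
    and "\<And>k. k \<in> {1..N} \<Longrightarrow> G k \<subseteq> predictors p"
    and "\<And>t. t \<in> {1..n} \<Longrightarrow> x t \<in> space S"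
    and "\<And>k. k \<in> {1..N} \<Longrightarrow>
           is_arg_min (\<lambda>g. \<Sum>t = 1..n. loss_at Ltilde p g (x t)) (\<lambda>g. g \<in> G k) (ghat k)"
    and "is_arg_min (\<lambda>k. EL (ghat k)) (\<lambda>k. k \<in> {1..N}) ktilde"
    and "khat \<in> PiM {n + 1..n + m} (\<lambda>_. S) \<rightarrow>\<^sub>M count_space UNIV"
    and "\<And>v. v \<in> space (PiM {n + 1..n + m} (\<lambda>_. S)) \<Longrightarrow>
           is_arg_min (\<lambda>k. empirical_loss L p n m v (ghat k)) (\<lambda>k. k \<in> {1..N}) (khat v)"
  shows "(\<integral>v. (EL (ghat (khat v)) - EL (ghat ktilde)) \<partial>V) \<le> bound
       \<and> (\<forall>gstar. is_arg_min EL (\<lambda>g. g \<in> predictors p) gstar \<longrightarrow>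
            (\<integral>v. (EL (ghat (khat v)) - EL gstar) \<partial>V) \<le> EL (ghat ktilde) - EL gstar + bound)"
proof -
  note k0 = assms(8) and k0p = assms(9) and n = assms(10) and m = assms(11) and N = assms(12)
    and chain = assms(13) and st = assms(14) and erg = assms(15) and L = assms(16) and G = assms(18)
    and xS = assms(19) and ghat = assms(20) and ktilde = assms(21) and khat = assms(22) and khat_min = assms(23)
  \<comment> \<open>The blocks have length \<open>p + 1\<close>, which is at least the order of the
    chain.\<close>
  interpret mixing_markov_kernel S K Q "mixing_time S K Q"
    unfolding S_def K_def Q_def using k0p by (intro mixing_markov_kernel_blocks chain st k0 erg) simp
  have xn: "x n \<in> space S" using xS n by simp
  define f where "f k = loss_at L p (ghat k)" for k
  define reindex where "reindex \<omega> = (\<lambda>j\<in>{n + 1..n + m}. \<omega> (j - n))" for \<omega> :: "nat \<Rightarrow> nat \<Rightarrow> 'y"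
  \<comment> \<open>The selection rule pulled back to paths that include the starting point, where
    times run from 1 to \<open>m\<close>.\<close>
  define sel where "sel \<omega> = khat (reindex \<omega>)" for \<omega>
  have f: "f k \<in> borel_measurable S" if "k \<in> {1..N}" for k
  proof -
    have "ghat k \<in> predictors p"
      using ghat[OF that] G[OF that] by (auto simp: is_arg_min_def)
    then show ?thesis
      unfolding f_def S_def by (rule measurable_loss_at[OF L])
  qed
  have f01: "0 \<le> f k y \<and> f k y \<le> 1" for k y
    using L by (simp add: f_def loss_at_def loss_function_def)
  have EL: "EL (ghat k) = (\<integral>y. f k y \<partial>Q)" for k
    by (simp add: EL_def expected_loss_def f_def)
  interpret P: prob_space "path_law (x n) m" by (rule prob_space_path_law[OF xn])
  have reindex: "reindex \<in> path_law (x n) m \<rightarrow>\<^sub>M PiM {n + 1..n + m} (\<lambda>_. S)"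
    unfolding measurable_cong_sets[OF sets_path_law[OF xn] refl] reindex_def[abs_def]
    by (intro measurable_restrict measurable_component_singleton) auto
  have V: "V = distr (path_law (x n) m) (PiM {n + 1..n + m} (\<lambda>_. S)) reindex"
    unfolding V_def validation_law_eq reindex_def[abs_def] ..
  interpret V: prob_space V unfolding V by (rule P.prob_space_distr[OF reindex])
  have sel: "sel \<in> path_law (x n) m \<rightarrow>\<^sub>M count_space UNIV"
    unfolding sel_def[abs_def] by (rule measurable_compose[OF reindex khat])
  have arg_min: "is_arg_min (\<lambda>k. empirical_loss L p n m (reindex \<omega>) (ghat k)) (\<lambda>k. k \<in> {1..N}) (sel \<omega>)"
    if "\<omega> \<in> space (path_law (x n) m)" for \<omega>
    unfolding sel_def by (rule khat_min[OF measurable_space[OF reindex that]])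
  have sel_range: "sel \<omega> \<in> {1..N}" if "\<omega> \<in> space (path_law (x n) m)" for \<omega>
    using arg_min[OF that] by (simp add: is_arg_min_def)
  have b: "ktilde \<in> {1..N}" using ktilde by (simp add: is_arg_min_def)
  have sel_min: "(\<Sum>j = 1..m. f (sel \<omega>) (\<omega> j)) \<le> (\<Sum>j = 1..m. f ktilde (\<omega> j))"
    if "\<omega> \<in> space (path_law (x n) m)" for \<omega>
  proof -
    have "empirical_loss L p n m (reindex \<omega>) (ghat (sel \<omega>)) \<le> empirical_loss L p n m (reindex \<omega>) (ghat ktilde)"
      using arg_min[OF that] b by (auto simp: is_arg_min_linorder)
    then show ?thesis
      using m unfolding reindex_def empirical_loss_reindex f_def by (simp add: divide_le_cancel)
  qed
  note selection = f f01 xn m sel sel_range sel_min b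
  \<comment> \<open>\<open>V\<close> is the image of the path law under \<open>reindex\<close>.
    Keeping \<open>c\<close> arbitrary serves both the comparison with \<open>ktilde\<close> and the
    one with \<open>gstar\<close>.\<close>
  have to_V: "integrable V (\<lambda>v. EL (ghat (khat v)) - c)"
    "(\<integral>v. EL (ghat (khat v)) - c \<partial>V) = (\<integral>\<omega>. (\<integral>y. f (sel \<omega>) y \<partial>Q) - c \<partial>path_law (x n) m)" for c
  proof -
    have meas: "(\<lambda>v. EL (ghat (khat v)) - c) \<in> borel_measurable (PiM {n + 1..n + m} (\<lambda>_. S))"
      by (rule measurable_compose[OF khat]) simp
    have "integrable (path_law (x n) m) (\<lambda>\<omega>. (\<integral>y. f (sel \<omega>) y \<partial>Q) - c)"
      by (rule integrable_selected_excess[where N = N and b = ktilde]) (use selection in auto)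
    then show "integrable V (\<lambda>v. EL (ghat (khat v)) - c)"
      unfolding V integrable_distr_eq[OF reindex meas] by (simp add: EL sel_def)
    show "(\<integral>v. EL (ghat (khat v)) - c \<partial>V) = (\<integral>\<omega>. (\<integral>y. f (sel \<omega>) y \<partial>Q) - c \<partial>path_law (x n) m)"
      unfolding V integral_distr[OF reindex meas] by (simp add: EL sel_def)
  qed
  have t: "1 \<le> tmix" using t_pos by (simp add: tmix_def)
  note rate = rate_le_bound[OF N m t]
  have "(\<integral>v. EL (ghat (khat v)) - EL (ghat ktilde) \<partial>V)
      \<le> 6 * sqrt (ln (exp 1 * real N * (2 * exp (ln 2 / tmix) + 1)) * (tmix / real m))"
    unfolding to_V(2)
    unfolding EL tmix_def
    by (rule selection_excess_bound[where N = N])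
      (use selection rate(1) in \<open>auto simp: tmix_def\<close>)
  also have "\<dots> \<le> bound"
    unfolding bound_def by (rule rate(2))
  finally have main: "(\<integral>v. EL (ghat (khat v)) - EL (ghat ktilde) \<partial>V) \<le> bound" .
  \<comment> \<open>Replacing the reference value by \<open>c\<close> adds a constant, which keeps
    its value under the probability measure \<open>V\<close>; the second claim takes
    \<open>c = EL gstar\<close>.\<close>
  have "(\<integral>v. EL (ghat (khat v)) - c \<partial>V) \<le> EL (ghat ktilde) - c + bound" for c
  proof -
    have "(\<integral>v. EL (ghat (khat v)) - c \<partial>V)
        = (\<integral>v. (EL (ghat (khat v)) - EL (ghat ktilde)) + (EL (ghat ktilde) - c) \<partial>V)"
      by simp
    also have "\<dots> = (\<integral>v. EL (ghat (khat v)) - EL (ghat ktilde) \<partial>V) + (EL (ghat ktilde) - c)"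
      using to_V(1)[of "EL (ghat ktilde)"] by (subst Bochner_Integration.integral_add) (auto simp: V.prob_space)
    finally show ?thesis using main by linarith
  qed
  with main show ?thesis by blast
qed

end
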